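(* Let $\xi=(\xi_t)_{0\le t\le T}$ be progressively measurable with $\xi_0\in L^2(\mathbb P)$ and $\mathbb E\int_0^T\xi_t^2\,dt<\infty$, let $x\in\mathbb R$, and let $\Xi_T\in L^2(\mathcal F_T)$ satisfy $\int_0^T\frac{d\,\mathbb E[\Xi_t^2]}{T-t}<\infty$, where $\Xi_t=\mathbb E[\Xi_T\mid\mathcal F_t]$. Assume that $[\xi]^2_{\rm tr}<\infty$. Then for every $\kappa\in(0,T^2/4]$, $$v^c(\kappa)\le6\sqrt\kappa\,\bigl(\mathbb E[(x-\xi_0)^2]+2[\xi]^2_{\rm tr}\bigr)+6\,\Theta(\sqrt\kappa)+6\kappa\,\Lambda(\sqrt\kappa).$$ In particular, if $\Theta(a)=O(a)$ as $a\downarrow0$, then $v^c(\kappa)=O(\sqrt\kappa)$ as $\kappa\downarrow0$.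
   Context: Fix $T>0$, a filtered probability space $(\Omega,\mathcal F,(\mathcal F_t)_{0\le t\le T},\mathbb P)$ satisfying the usual conditions, and $x\in\mathbb R$. Let $\mathcal U$ be the set of progressively measurable processes $u$ on $[0,T]$ with $\mathbb E\int_0^T u_t^2\,dt<\infty$; for $u\in\mathcal U$ let $X^u_t=x+\int_0^tu_s\,ds$ and, for $\kappa\ge0$, $$J_\kappa(u)=\mathbb E\Big[\tfrac12\int_0^T(X^u_t-\xi_t)^2\,dt+\tfrac\kappa2\int_0^Tu_t^2\,dt\Big].$$ $(\Xi_t)_{0\le t\le T}$ is the càdlàg version of $\mathbb E[\Xi_T\mid\mathcal F_t]$. The constrained value is $v^c(\kappa)=\inf_{u\in\mathcal U^c}J_\kappa(u)$, where $\mathcal U^c=\{u\in\mathcal U: X^u_T=\Xi_T\ \mathbb P\text{-a.s.}\}$. For $h>0$, $\omega_\xi(h)=\mathbb E\int_0^T|\xi_t-\xi_{(t-h)^+}|^2\,dt$ with $(t-h)^+=\max\{t-h,0\}$, and $[\xi]^2_{\rm tr}=\sup_{h>0}\omega_\xi(h)/h$. For $0<a\le T/2$, $$\Theta(a)=\mathbb E\int_{T-2a}^T|\xi_t-\Xi_t|^2\,dt,\qquad \Lambda(a)=\int_{T-2a}^T\frac{d\,\mathbb E[\Xi_t^2]}{T-t}.$$ Integrals with respect to $d\,\mathbb E[\Xi_t^2]$ are Stieltjes integrals with respect to the nondecreasing function $t\mapsto\mathbb E[\Xi_t^2]$ on $[0,T]$, with the convention that an atom at $T$ contributes $+\infty$.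 *)

theory Defs
  imports "HOL-Probability.Probability"
begin

locale usual_filtered_prob_space = prob_space M + complete_measure M
  for M :: "'a measure" +
  fixes T :: real and F :: "real \<Rightarrow> 'a measure"
  assumes T_pos: "T > 0"
    and subalgebra_F: "\<And>t. t \<in> {0..T} \<Longrightarrow> subalgebra M (F t)"
    and sets_F_mono: "\<And>s t. 0 \<le> s \<Longrightarrow> s \<le> t \<Longrightarrow> t \<le> T \<Longrightarrow> sets (F s) \<subseteq> sets (F t)"
    and null_sets_F: "null_sets M \<subseteq> sets (F 0)"
    and right_continuous_F: "\<And>t. t \<in> {0..<T} \<Longrightarrow> (\<Inter>s\<in>{t<..T}. sets (F s)) = sets (F t)"

definition progressive :: "real \<Rightarrow> (real \<Rightarrow> 'a measure) \<Rightarrow> (real \<Rightarrow> 'a \<Rightarrow> real) \<Rightarrow> bool" where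
  "progressive T F X \<longleftrightarrow>
     (\<forall>t\<in>{0..T}. (\<lambda>(s, \<omega>). X s \<omega>) \<in> borel_measurable (restrict_space borel {0..t} \<Otimes>\<^sub>M F t))"

definition cadlag_on :: "real \<Rightarrow> (real \<Rightarrow> real) \<Rightarrow> bool" where
  "cadlag_on T f \<longleftrightarrow>
     (\<forall>t\<in>{0..<T}. (f \<longlongrightarrow> f t) (at_right t)) \<and>
     (\<forall>t\<in>{0<..T}. \<exists>l. (f \<longlongrightarrow> l) (at_left t))"

definition cadlag_cond_exp ::
  "'a measure \<Rightarrow> real \<Rightarrow> (real \<Rightarrow> 'a measure) \<Rightarrow> ('a \<Rightarrow> real) \<Rightarrow> (real \<Rightarrow> 'a \<Rightarrow> real) \<Rightarrow> bool" where
  "cadlag_cond_exp M T F \<Xi>\<^sub>T \<Xi> \<longleftrightarrow>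
     (\<forall>t\<in>{0..T}. \<Xi> t \<in> borel_measurable (F t) \<and> (AE \<omega> in M. \<Xi> t \<omega> = real_cond_exp M (F t) \<Xi>\<^sub>T \<omega>)) \<and>
     (\<forall>\<omega>\<in>space M. cadlag_on T (\<lambda>t. \<Xi> t \<omega>))"

text \<open>All expectations below are of nonnegative quantities and hence \<^typ>\<open>ennreal\<close>-valued.\<close>

definition time_energy :: "'a measure \<Rightarrow> real \<Rightarrow> real \<Rightarrow> (real \<Rightarrow> 'a \<Rightarrow> real) \<Rightarrow> ennreal" where
  "time_energy M a b Y = (\<integral>\<^sup>+\<omega>. (\<integral>\<^sup>+t\<in>{a..b}. ennreal ((Y t \<omega>)\<^sup>2) \<partial>lborel) \<partial>M)"

definition controls :: "'a measure \<Rightarrow> real \<Rightarrow> (real \<Rightarrow> 'a measure) \<Rightarrow> (real \<Rightarrow> 'a \<Rightarrow> real) set" where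
  "controls M T F = {u. progressive T F u \<and> time_energy M 0 T u < \<top>}"

definition state :: "real \<Rightarrow> (real \<Rightarrow> 'a \<Rightarrow> real) \<Rightarrow> real \<Rightarrow> 'a \<Rightarrow> real" where
  "state x u t \<omega> = x + (LINT s:{0..t}|lborel. u s \<omega>)"

definition cost ::
  "'a measure \<Rightarrow> real \<Rightarrow> real \<Rightarrow> (real \<Rightarrow> 'a \<Rightarrow> real) \<Rightarrow> real \<Rightarrow> (real \<Rightarrow> 'a \<Rightarrow> real) \<Rightarrow> ennreal" where
  "cost M T x \<xi> \<kappa> u =
     (\<integral>\<^sup>+\<omega>. ennreal (1/2) * (\<integral>\<^sup>+t\<in>{0..T}. ennreal ((state x u t \<omega> - \<xi> t \<omega>)\<^sup>2) \<partial>lborel)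
          + ennreal (\<kappa>/2) * (\<integral>\<^sup>+t\<in>{0..T}. ennreal ((u t \<omega>)\<^sup>2) \<partial>lborel) \<partial>M)"

definition constrained_controls ::
  "'a measure \<Rightarrow> real \<Rightarrow> (real \<Rightarrow> 'a measure) \<Rightarrow> real \<Rightarrow> ('a \<Rightarrow> real) \<Rightarrow> (real \<Rightarrow> 'a \<Rightarrow> real) set" where
  "constrained_controls M T F x \<Xi>\<^sub>T =
     {u \<in> controls M T F. AE \<omega> in M. state x u T \<omega> = \<Xi>\<^sub>T \<omega>}"

definition constrained_value ::
  "'a measure \<Rightarrow> real \<Rightarrow> (real \<Rightarrow> 'a measure) \<Rightarrow> real \<Rightarrow> (real \<Rightarrow> 'a \<Rightarrow> real) \<Rightarrow> ('a \<Rightarrow> real)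
     \<Rightarrow> real \<Rightarrow> ennreal" where
  "constrained_value M T F x \<xi> \<Xi>\<^sub>T \<kappa> = (INF u\<in>constrained_controls M T F x \<Xi>\<^sub>T. cost M T x \<xi> \<kappa> u)"

definition transl_modulus :: "'a measure \<Rightarrow> real \<Rightarrow> (real \<Rightarrow> 'a \<Rightarrow> real) \<Rightarrow> real \<Rightarrow> ennreal" where
  "transl_modulus M T \<xi> h = time_energy M 0 T (\<lambda>t \<omega>. \<xi> t \<omega> - \<xi> (max (t - h) 0) \<omega>)"

definition transl_seminorm_sq :: "'a measure \<Rightarrow> real \<Rightarrow> (real \<Rightarrow> 'a \<Rightarrow> real) \<Rightarrow> ennreal" where
  "transl_seminorm_sq M T \<xi> = (SUP h\<in>{0<..}. transl_modulus M T \<xi> h / ennreal h)"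

definition terminal_gap ::
  "'a measure \<Rightarrow> real \<Rightarrow> (real \<Rightarrow> 'a \<Rightarrow> real) \<Rightarrow> (real \<Rightarrow> 'a \<Rightarrow> real) \<Rightarrow> real \<Rightarrow> ennreal" where
  "terminal_gap M T \<xi> \<Xi> a = time_energy M (T - 2 * a) T (\<lambda>t \<omega>. \<xi> t \<omega> - \<Xi> t \<omega>)"

text \<open>
  The function \<open>t \<mapsto> E[\<Xi>\<^sub>t\<^sup>2]\<close> on \<open>[0,T]\<close> is extended by its boundary values, so the Stieltjes measure
  lives on \<open>(0,T]\<close>. As usual, \<open>\<integral>\<^sub>b\<^sup>T\<close> against it is over \<open>(b,T]\<close>. At \<open>t = T\<close> the integrand is
  \<open>1 / 0 = \<top>\<close> in \<^typ>\<open>ennreal\<close>, so an atom at \<open>T\<close> contributes \<open>\<top>\<close>, and a null endpoint nothing.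
  \<open>interval_measure\<close> needs a nondecreasing right-continuous function; this holds for the second
  moment of a cadlag square-integrable martingale.
\<close>

definition second_moment_measure :: "'a measure \<Rightarrow> real \<Rightarrow> (real \<Rightarrow> 'a \<Rightarrow> real) \<Rightarrow> real measure" where
  "second_moment_measure M T \<Xi> =
     interval_measure (\<lambda>t. LINT \<omega>|M. (\<Xi> (max 0 (min T t)) \<omega>)\<^sup>2)"

definition information_integral ::
  "'a measure \<Rightarrow> real \<Rightarrow> (real \<Rightarrow> 'a \<Rightarrow> real) \<Rightarrow> real \<Rightarrow> ennreal" where
  "information_integral M T \<Xi> b =
     (\<integral>\<^sup>+t\<in>{b<..T}. 1 / ennreal (T - t) \<partial>second_moment_measure M T \<Xi>)"

definition terminal_information ::
  "'a measure \<Rightarrow> real \<Rightarrow> (real \<Rightarrow> 'a \<Rightarrow> real) \<Rightarrow> real \<Rightarrow> ennreal" where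
  "terminal_information M T \<Xi> a = information_integral M T \<Xi> (T - 2 * a)"

end

theory Submission
  imports Defs
begin

text \<open>
  Put \<open>a = sqrt \<kappa>\<close>. Up to a switching time \<open>\<tau> \<in> [T - 2a, T - a]\<close> the state follows the moving average of
  \<open>\<xi>\<close> over a window of length \<open>a\<close>, corrected for the initial value. Its tracking error and its
  \<open>\<kappa>\<close>-weighted control energy are both of order \<open>a (E[(x - \<xi>\<^sub>0)\<^sup>2] + [\<xi>]\<^sup>2)\<close>, since the control is a
  difference quotient of \<open>\<xi>\<close>. After \<open>\<tau>\<close> the state is interpolated linearly between the dyadic
  times \<open>t\<^sub>k = T - (T - \<tau>) / 2\<^sup>k\<close>, reaching \<open>\<Xi>\<close> evaluated at \<open>t\<^sub>k\<close> at the next time \<open>t\<^sub>k\<^sub>+\<^sub>1\<close>, so that it is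
  adapted. By orthogonality of martingale increments the energy of this phase is a sum of
  increments of \<open>E[\<Xi>\<^sub>t\<^sup>2]\<close> divided by \<open>T - t\<close>, hence at most \<open>4 \<Lambda>\<close> plus the
  contribution of the gap \<open>X\<^sub>\<tau> - \<Xi>\<^sub>\<tau>\<close>. The gap cannot be controlled at a fixed \<open>\<tau>\<close>; averaging the resulting
  bound over \<open>\<tau> \<in> [T - 2a, T - a]\<close> replaces it by the tracking error and \<open>\<Theta>\<close>.
\<close>

section \<open>Progressive processes\<close>

text \<open>The translation seminorm and \<open>\<Theta>\<close> are integrals over time, so they
  say nothing about the gap at one prescribed time. Averaging over an interval of length
  \<open>a\<close> costs a factor \<open>1/a\<close>, which is repaid by the weight of the gap:
  \<open>(T - \<tau>)/2\<close> from tracking on the first segment plus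
  \<open>\<kappa>/(T - \<tau>)\<close> from its energy. With \<open>\<kappa> = a^2\<close> both are
  of order \<open>a\<close> exactly when \<open>T - \<tau>\<close> is comparable to \<open>a\<close>
  from both sides, whence the range of \<open>\<tau>\<close>. The knots must accumulate at
  \<open>T\<close>, since \<open>\<Xi>\<close> is revealed up to the end while the control may use
  observed values only. Halving the remaining time keeps the time left at a knot equal to four times
  the length of the segment on which the increment just observed is paid for; this is the origin of
  the 4 in front of \<open>\<Lambda>\<close>. Exact hitting is a separate point: by construction the
  state at \<open>T\<close> is a left limit of the martingale, and a jump at \<open>T\<close> has to
  be excluded. The finite information integral does this, as it forces the second moments to
  converge to the one at \<open>T\<close>.\<close>

lemma right_continuous_process_measurable:
  fixes f :: "real \<Rightarrow> 'a \<Rightarrow> real"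
  assumes meas: "\<And>t. f t \<in> borel_measurable M"
    and cont: "\<And>t \<omega>. \<omega> \<in> space M \<Longrightarrow> ((\<lambda>s. f s \<omega>) \<longlongrightarrow> f t \<omega>) (at_right t)"
  shows "(\<lambda>(t, \<omega>). f t \<omega>) \<in> borel_measurable (borel \<Otimes>\<^sub>M M)"
proof -
  \<comment> \<open>The first point strictly after \<open>t\<close> of the grid with mesh
    \<open>1 / Suc n\<close>. Strictness is what convergence along \<open>at_right t\<close>
    demands; only countably many values occur, so \<open>f (r n t)\<close> is jointly
    measurable.\<close>
  define r where "r n t = (of_int \<lfloor>real (Suc n) * t\<rfloor> + 1) / real (Suc n)" for n :: nat and t :: real
  have r_gt: "r n t > t" for n t
    unfolding r_def by (simp add: field_simps) linarith
  have r_le: "r n t \<le> t + 1 / real (Suc n)" for n t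
  proof -
    have "r n t \<le> (real (Suc n) * t + 1) / real (Suc n)"
      unfolding r_def by (intro divide_right_mono) auto
    also have "\<dots> = t + 1 / real (Suc n)"
      by (simp add: add_divide_distrib)
    finally show ?thesis .
  qed
  have r_lim: "(\<lambda>n. r n t) \<longlonglongrightarrow> t" for t
  proof (rule tendsto_sandwich[OF _ _ tendsto_const])
    show "\<forall>\<^sub>F n in sequentially. t \<le> r n t" using r_gt by (intro always_eventually) (auto intro: less_imp_le)
    show "\<forall>\<^sub>F n in sequentially. r n t \<le> t + 1 / real (Suc n)" using r_le by simp
    show "(\<lambda>n. t + 1 / real (Suc n)) \<longlonglongrightarrow> t"
      using tendsto_add[OF tendsto_const LIMSEQ_inverse_real_of_nat, of t] by (simp add: inverse_eq_divide)
  qed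
  show ?thesis
  proof (rule borel_measurable_LIMSEQ_real)
    fix p :: "real \<times> 'a" assume "p \<in> space (borel \<Otimes>\<^sub>M M)"
    then obtain t \<omega> where p: "p = (t, \<omega>)" "\<omega> \<in> space M" by (auto simp: space_pair_measure)
    have "filterlim (\<lambda>n. r n t) (at_right t) sequentially"
      unfolding filterlim_at using r_lim r_gt[of t] by (auto simp: less_imp_neq[symmetric])
    then show "(\<lambda>n. (case p of (t, \<omega>) \<Rightarrow> f (r n t) \<omega>)) \<longlonglongrightarrow> (case p of (t, \<omega>) \<Rightarrow> f t \<omega>)"
      using filterlim_compose[OF cont[OF p(2), of t]] p by simp
  next
    fix n
    have "(\<lambda>p. (\<lambda>i p. f ((of_int i + 1) / real (Suc n)) (snd p)) \<lfloor>real (Suc n) * fst p\<rfloor> p)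
        \<in> borel_measurable (borel \<Otimes>\<^sub>M M)"
      by (rule measurable_compose_countable) (use meas in measurable)
    then show "(\<lambda>p. case p of (t, \<omega>) \<Rightarrow> f (r n t) \<omega>) \<in> borel_measurable (borel \<Otimes>\<^sub>M M)"
      by (simp add: r_def split_beta')
  qed
qed

text \<open>Clamping time to \<open>{0..t}\<close> replaces the restricted time domain by the whole
  line, so that Fubini with \<open>lborel\<close> becomes available. The first part keeps the
  information \<open>F t\<close>, the second enlarges it to \<open>M\<close>.\<close>

lemma progressive_clamped_measurable:
  assumes "progressive T F X" "t \<in> {0..T}" "subalgebra M (F t)"
  shows "(\<lambda>(s, \<omega>). X (max 0 (min t s)) \<omega>) \<in> borel_measurable (borel \<Otimes>\<^sub>M F t)"
    and "(\<lambda>(s, \<omega>). X (max 0 (min t s)) \<omega>) \<in> borel_measurable (borel \<Otimes>\<^sub>M M)"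
proof -
  have X: "(\<lambda>(s, \<omega>). X s \<omega>) \<in> borel_measurable (restrict_space borel {0..t} \<Otimes>\<^sub>M F t)"
    using assms by (auto simp: progressive_def)
  have c: "(\<lambda>s. max 0 (min t s)) \<in> borel \<rightarrow>\<^sub>M restrict_space borel {0..t}"
    using assms(2) by (intro measurable_restrict_space2) auto
  have "(\<lambda>p. (max 0 (min t (fst p)), snd p)) \<in> borel \<Otimes>\<^sub>M F t \<rightarrow>\<^sub>M restrict_space borel {0..t} \<Otimes>\<^sub>M F t"
    using measurable_compose[OF measurable_fst c] by measurable
  from measurable_compose[OF this X]
  show 1: "(\<lambda>(s, \<omega>). X (max 0 (min t s)) \<omega>) \<in> borel_measurable (borel \<Otimes>\<^sub>M F t)"
    by (simp add: split_beta')
  have "(\<lambda>p. (fst p, snd p)) \<in> borel \<Otimes>\<^sub>M M \<rightarrow>\<^sub>M borel \<Otimes>\<^sub>M F t"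
    using measurable_compose[OF measurable_snd measurable_from_subalg[OF assms(3) measurable_ident]]
    by (intro measurable_Pair) (auto simp: id_def)
  from measurable_compose[OF this 1]
  show "(\<lambda>(s, \<omega>). X (max 0 (min t s)) \<omega>) \<in> borel_measurable (borel \<Otimes>\<^sub>M M)"
    by (simp add: split_beta')
qed

text \<open>A parameter integral of an integrand jointly measurable for \<open>F t\<close>; on
  \<open>{0..t}\<close> the clamping changes nothing.\<close>

lemma progressive_state_measurable:
  assumes "progressive T F u" "t \<in> {0..T}"
  shows "state x u t \<in> borel_measurable (F t)"
proof -
  have m: "(\<lambda>(s, \<omega>). u (max 0 (min t s)) \<omega>) \<in> borel_measurable (borel \<Otimes>\<^sub>M F t)"
    using progressive_clamped_measurable(1)[OF assms, of "F t"] by (simp add: subalgebra_def)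
  have "(\<lambda>(\<omega>, s). indicator {0..t} s * u (max 0 (min t s)) \<omega>) \<in> borel_measurable (F t \<Otimes>\<^sub>M lborel)"
    using measurable_compose[OF measurable_Pair[OF measurable_snd measurable_fst] m] by (simp add: split_beta')
  then have "(\<lambda>\<omega>. LINT s|lborel. indicator {0..t} s * u (max 0 (min t s)) \<omega>) \<in> borel_measurable (F t)"
    by (rule lborel.borel_measurable_lebesgue_integral)
  also have "(\<lambda>\<omega>. LINT s|lborel. indicator {0..t} s * u (max 0 (min t s)) \<omega>) = (\<lambda>\<omega>. LINT s:{0..t}|lborel. u s \<omega>)"
    unfolding set_lebesgue_integral_def
    by (intro ext Bochner_Integration.integral_cong) (auto simp: indicator_def)
  finally show ?thesis unfolding state_def[abs_def] by measurable
qed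

lemma state_jointly_measurable:
  assumes "(\<lambda>(s, \<omega>). u s \<omega>) \<in> borel_measurable (borel \<Otimes>\<^sub>M M)"
  shows "(\<lambda>(t, \<omega>). state x u t \<omega>) \<in> borel_measurable (borel \<Otimes>\<^sub>M M)"
proof -
  note assms[measurable]
  have "(\<lambda>(p, s). indicator {0..fst p} s *\<^sub>R u s (snd p)) \<in> borel_measurable ((borel \<Otimes>\<^sub>M M) \<Otimes>\<^sub>M lborel)"
  proof -
    have "(\<lambda>q. u (snd q) (snd (fst q))) \<in> borel_measurable ((borel \<Otimes>\<^sub>M M) \<Otimes>\<^sub>M lborel)"
      using measurable_compose[OF measurable_Pair[OF measurable_snd measurable_compose[OF measurable_fst measurable_snd]] assms]
      by simp
    moreover have "(\<lambda>q. indicator {0::real..fst (fst q)} (snd q) :: real) \<in> borel_measurable ((borel \<Otimes>\<^sub>M M) \<Otimes>\<^sub>M lborel)"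
    proof -
      have m: "(\<lambda>q. fst (fst q) - snd q :: real) \<in> borel_measurable ((borel \<Otimes>\<^sub>M M) \<Otimes>\<^sub>M lborel)"
        "(\<lambda>q. snd q :: real) \<in> borel_measurable ((borel \<Otimes>\<^sub>M M) \<Otimes>\<^sub>M lborel)"
        using measurable_compose[OF measurable_fst measurable_fst]
        by (auto intro!: borel_measurable_diff)
      have i: "indicat_real {0::real..} \<in> borel_measurable borel"
        by simp
      \<comment> \<open>The interval \<open>{0..t}\<close> moves with the outer time variable; its
        indicator is split into two conditions \<open>s \<ge> 0\<close> and
        \<open>t - s \<ge> 0\<close> on fixed half-lines.\<close>
      have "(\<lambda>q. indicator {0..} (snd q) * indicator {0::real..} (fst (fst q) - snd q) :: real)
          \<in> borel_measurable ((borel \<Otimes>\<^sub>M M) \<Otimes>\<^sub>M lborel)"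
        by (intro borel_measurable_times measurable_compose[OF m(1) i] measurable_compose[OF m(2) i])
      moreover have "indicator {0..} s * indicator {0..} (t - s) = (indicator {0..t} s :: real)" for s t :: real
        by (auto simp: indicator_def)
      ultimately show ?thesis by simp
    qed
    ultimately show ?thesis
      unfolding split_beta' by (intro borel_measurable_scaleR)
  qed
  from lborel.borel_measurable_lebesgue_integral[OF this]
  show ?thesis
    unfolding state_def set_lebesgue_integral_def split_beta' by measurable
qed

lemma progressive_add:
  assumes "progressive T F X" "progressive T F Y"
  shows "progressive T F (\<lambda>t \<omega>. X t \<omega> + Y t \<omega>)"
  using assms unfolding progressive_def split_beta' by (auto intro: borel_measurable_add)

lemma progressive_cmult:
  assumes "progressive T F X"
  shows "progressive T F (\<lambda>t \<omega>. c * X t \<omega>)"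
  using assms unfolding progressive_def split_beta' by (auto intro: borel_measurable_times)

lemma progressive_suminf:
  assumes "\<And>k::nat. progressive T F (X k)"
  shows "progressive T F (\<lambda>t \<omega>. \<Sum>k. X k t \<omega>)"
  using assms unfolding progressive_def split_beta' by (auto intro: borel_measurable_suminf)

lemma progressive_time_mult:
  assumes "progressive T F X" "g \<in> borel_measurable borel"
  shows "progressive T F (\<lambda>t \<omega>. g t * X t \<omega>)"
proof -
  have "(\<lambda>p. g (fst p)) \<in> borel_measurable (restrict_space borel {0..t} \<Otimes>\<^sub>M F t)" for t
    by (rule measurable_compose[OF measurable_fst]) (rule measurable_restrict_space1[OF assms(2)])
  then show ?thesis
    using assms(1) unfolding progressive_def split_beta' by (auto intro: borel_measurable_times)
qed

text \<open>Because \<open>h \<ge> 0\<close>, the map \<open>s \<mapsto> max (s - h) 0\<close> sends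
  \<open>{0..t}\<close> into itself: looking back stays within the observed past.\<close>

lemma progressive_delay:
  assumes "progressive T F X" "h \<ge> 0"
  shows "progressive T F (\<lambda>t \<omega>. X (max (t - h) 0) \<omega>)"
  unfolding progressive_def
proof
  fix t assume t: "t \<in> {0..T}"
  have "(\<lambda>s. max (s - h) 0) \<in> restrict_space borel {0..t} \<rightarrow>\<^sub>M restrict_space borel {0..t}"
    using assms(2) t by (intro measurable_restrict_space2 measurable_restrict_space1) (auto simp: space_restrict_space)
  then have "(\<lambda>p. (max (fst p - h) 0, snd p)) \<in> restrict_space borel {0..t} \<Otimes>\<^sub>M F t \<rightarrow>\<^sub>M restrict_space borel {0..t} \<Otimes>\<^sub>M F t"
    using measurable_compose[OF measurable_fst] by (intro measurable_Pair) auto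
  from measurable_compose[OF this, of "\<lambda>(s, \<omega>). X s \<omega>" borel] assms(1) t
  show "(\<lambda>(s, \<omega>). X (max (s - h) 0) \<omega>) \<in> borel_measurable (restrict_space borel {0..t} \<Otimes>\<^sub>M F t)"
    unfolding progressive_def by (simp add: split_beta')
qed

text \<open>A value known at time \<open>s\<close> may be used from \<open>s\<close> on. For
  \<open>t < s\<close> the process is identically 0 on \<open>{0..t}\<close>, because
  \<open>A \<subseteq> {s..}\<close>.\<close>

lemma progressive_after:
  assumes "Z \<in> borel_measurable (F s)" "\<And>t. s \<le> t \<Longrightarrow> t \<le> T \<Longrightarrow> subalgebra (F t) (F s)"
    "A \<in> sets borel" "A \<subseteq> {s..}"
  shows "progressive T F (\<lambda>t \<omega>. indicator A t * Z \<omega>)"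
  unfolding progressive_def
proof
  fix t assume t: "t \<in> {0..T}"
  show "(\<lambda>(r, \<omega>). indicator A r * Z \<omega>) \<in> borel_measurable (restrict_space borel {0..t} \<Otimes>\<^sub>M F t)"
  proof (cases "s \<le> t")
    case True
    have "Z \<in> borel_measurable (F t)"
      using measurable_from_subalg[OF assms(2) assms(1)] True t by auto
    moreover have "(\<lambda>p. indicator A (fst p) :: real) \<in> borel_measurable (restrict_space borel {0..t} \<Otimes>\<^sub>M F t)"
      by (rule measurable_compose[OF measurable_fst], rule measurable_restrict_space1) (use assms(3) in measurable)
    ultimately show ?thesis unfolding split_beta' by measurable
  next
    case False
    have "(\<lambda>(r, \<omega>). indicator A r * Z \<omega>) \<in> borel_measurable (restrict_space borel {0..t} \<Otimes>\<^sub>M F t)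
      \<longleftrightarrow> (\<lambda>p. 0::real) \<in> borel_measurable (restrict_space borel {0..t} \<Otimes>\<^sub>M F t)"
      using False assms(4) by (intro measurable_cong) (auto simp: space_pair_measure space_restrict_space indicator_def)
    then show ?thesis by simp
  qed
qed

section \<open>Square-integrable martingales\<close>

lemma integrable_mult_of_squares:
  fixes X Y :: "'a \<Rightarrow> real"
  assumes "X \<in> borel_measurable M" "Y \<in> borel_measurable M"
    and "integrable M (\<lambda>\<omega>. (X \<omega>)\<^sup>2)" "integrable M (\<lambda>\<omega>. (Y \<omega>)\<^sup>2)"
  shows "integrable M (\<lambda>\<omega>. X \<omega> * Y \<omega>)"
proof (rule Bochner_Integration.integrable_bound)
  show "integrable M (\<lambda>\<omega>. (X \<omega>)\<^sup>2 + (Y \<omega>)\<^sup>2)" using assms by simp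
  show "(\<lambda>\<omega>. X \<omega> * Y \<omega>) \<in> borel_measurable M" using assms by simp
  have "norm (X \<omega> * Y \<omega>) \<le> norm ((X \<omega>)\<^sup>2 + (Y \<omega>)\<^sup>2)" for \<omega>
    using sum_squares_bound[of "\<bar>X \<omega>\<bar>" "\<bar>Y \<omega>\<bar>"] mult_nonneg_nonneg[OF abs_ge_zero abs_ge_zero, of "X \<omega>" "Y \<omega>"]
    unfolding real_norm_def abs_mult power2_abs by linarith
  then show "AE \<omega> in M. norm (X \<omega> * Y \<omega>) \<le> norm ((X \<omega>)\<^sup>2 + (Y \<omega>)\<^sup>2)" by simp
qed

lemma integrable_diff_squared:
  fixes X Y :: "'a \<Rightarrow> real"
  assumes "X \<in> borel_measurable M" "Y \<in> borel_measurable M"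
    and "integrable M (\<lambda>\<omega>. (X \<omega>)\<^sup>2)" "integrable M (\<lambda>\<omega>. (Y \<omega>)\<^sup>2)"
  shows "integrable M (\<lambda>\<omega>. (X \<omega> - Y \<omega>)\<^sup>2)"
    and "(LINT \<omega>|M. (X \<omega> - Y \<omega>)\<^sup>2) =
      (LINT \<omega>|M. (X \<omega>)\<^sup>2) - 2 * (LINT \<omega>|M. X \<omega> * Y \<omega>) + (LINT \<omega>|M. (Y \<omega>)\<^sup>2)"
  using assms integrable_mult_of_squares[OF assms]
  by (simp_all add: power2_diff mult.assoc)

section \<open>The tracking problem and the martingale closed by the terminal value\<close>

locale tracking_problem = usual_filtered_prob_space M T F
  for M :: "'a measure" and T :: real and F :: "real \<Rightarrow> 'a measure" +
  fixes \<xi> \<Xi> :: "real \<Rightarrow> 'a \<Rightarrow> real" and \<Xi>\<^sub>T :: "'a \<Rightarrow> real" and x :: real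
  assumes progressive_xi: "progressive T F \<xi>"
    and xi_zero_L2: "integrable M (\<lambda>\<omega>. (\<xi> 0 \<omega>)\<^sup>2)"
    and xi_energy: "time_energy M 0 T \<xi> < \<top>"
    and terminal_measurable: "\<Xi>\<^sub>T \<in> borel_measurable (F T)"
    and terminal_L2: "integrable M (\<lambda>\<omega>. (\<Xi>\<^sub>T \<omega>)\<^sup>2)"
    and cadlag_Xi: "cadlag_cond_exp M T F \<Xi>\<^sub>T \<Xi>"
    and information_finite: "information_integral M T \<Xi> 0 < \<top>"
    and seminorm_finite: "transl_seminorm_sq M T \<xi> < \<top>"
begin

text \<open>Constant extension beyond \<open>[0,T]\<close>: for \<open>t\<close> in
  \<open>[0,T]\<close> and \<open>h \<ge> 0\<close>, \<open>target (t - h)\<close> is the value of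
  \<open>\<xi>\<close> at \<open>max (t - h) 0\<close>, and joint measurability holds on the whole
  line.\<close>

definition target :: "real \<Rightarrow> 'a \<Rightarrow> real" where
  "target t \<omega> = \<xi> (max 0 (min T t)) \<omega>"

definition mart :: "real \<Rightarrow> 'a \<Rightarrow> real" where
  "mart t \<omega> = \<Xi> (max 0 (min T t)) \<omega>"

text \<open>Since \<open>mart\<close> is clamped, this is the function that generates
  \<open>second_moment_measure\<close>.\<close>

definition second_moment :: "real \<Rightarrow> real" where
  "second_moment t = (LINT \<omega>|M. (mart t \<omega>)\<^sup>2)"

lemma clamp_idem [simp]: "max 0 (min T (max 0 (min T t))) = max 0 (min T t)"
  using T_pos by auto

lemma clamp_id: "t \<in> {0..T} \<Longrightarrow> max 0 (min T t) = t" by auto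

lemma subalgebra_F_mono:
  assumes "0 \<le> s" "s \<le> t" "t \<le> T"
  shows "subalgebra (F t) (F s)"
proof -
  have "s \<in> {0..T}" "t \<in> {0..T}" using assms by auto
  then have "space (F s) = space M" "space (F t) = space M"
    using subalgebra_F unfolding subalgebra_def by blast+
  then show ?thesis
    using sets_F_mono[OF assms] by (simp add: subalgebra_def)
qed

lemma F_measurable_imp_measurable: "f \<in> borel_measurable (F t) \<Longrightarrow> t \<in> {0..T} \<Longrightarrow> f \<in> borel_measurable M"
  by (rule measurable_from_subalg[OF subalgebra_F])

lemma terminal_measurable_M [measurable]: "\<Xi>\<^sub>T \<in> borel_measurable M"
  using F_measurable_imp_measurable[OF terminal_measurable] T_pos by auto

lemma integrable_of_square:
  assumes "Z \<in> borel_measurable M" "integrable M (\<lambda>\<omega>. (Z \<omega>)\<^sup>2 :: real)"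
  shows "integrable M Z"
  using integrable_mult_of_squares[of Z M "\<lambda>_. 1"] assms by simp

lemma terminal_integrable: "integrable M \<Xi>\<^sub>T"
  by (rule integrable_of_square[OF terminal_measurable_M terminal_L2])

lemma mart_measurable_F: "t \<in> {0..T} \<Longrightarrow> mart t \<in> borel_measurable (F t)"
  using cadlag_Xi by (auto simp: cadlag_cond_exp_def mart_def[abs_def] clamp_id)

lemma mart_measurable [measurable]: "mart t \<in> borel_measurable M"
proof -
  have "mart t = mart (max 0 (min T t))" by (rule ext) (auto simp: mart_def)
  then show ?thesis
    using F_measurable_imp_measurable[OF mart_measurable_F, of "max 0 (min T t)"] T_pos by simp
qed

lemma finite_measure_subalgebra_F: "t \<in> {0..T} \<Longrightarrow> finite_measure_subalgebra M (F t)"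
  using subalgebra_F by (unfold_locales) auto

lemma mart_AE: "t \<in> {0..T} \<Longrightarrow> AE \<omega> in M. mart t \<omega> = real_cond_exp M (F t) \<Xi>\<^sub>T \<omega>"
  using cadlag_Xi by (auto simp: cadlag_cond_exp_def mart_def clamp_id)

lemma mart_L2 [simp]: "integrable M (\<lambda>\<omega>. (mart t \<omega>)\<^sup>2)"
proof -
  have *: "integrable M (\<lambda>\<omega>. (mart t \<omega>)\<^sup>2)" if t: "t \<in> {0..T}" for t
  proof -
    interpret A: finite_measure_subalgebra M "F t" by (rule finite_measure_subalgebra_F[OF t])
    have i: "integrable M (real_cond_exp M (F t) \<Xi>\<^sub>T)"
      using A.real_cond_exp_int(1)[OF terminal_integrable] .
    have "integrable M (\<lambda>\<omega>. (real_cond_exp M (F t) \<Xi>\<^sub>T \<omega>)\<^sup>2)"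
    proof (rule A.integrable_convex_cond_exp[where I = UNIV and X = \<Xi>\<^sub>T])
      show "convex_on UNIV (\<lambda>x::real. x\<^sup>2)" by (rule convex_power2)
    qed (use terminal_integrable terminal_L2 in auto)
    then show ?thesis
      by (subst integrable_cong_AE[where g = "\<lambda>\<omega>. (real_cond_exp M (F t) \<Xi>\<^sub>T \<omega>)\<^sup>2"])
         (use mart_AE[OF t] in auto)
  qed
  have "mart t = mart (max 0 (min T t))" by (rule ext) (auto simp: mart_def)
  then show ?thesis using *[of "max 0 (min T t)"] T_pos by simp
qed

text \<open>A factor known at time \<open>t\<close> can be moved inside the conditional expectation.
  Two different times are later compared through the common value with
  \<open>\<Xi>\<^sub>T\<close>.\<close>

lemma cross_terminal:
  assumes "t \<in> {0..T}" "Z \<in> borel_measurable (F t)" "integrable M (\<lambda>\<omega>. (Z \<omega>)\<^sup>2)"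
  shows "(LINT \<omega>|M. Z \<omega> * mart t \<omega>) = (LINT \<omega>|M. Z \<omega> * \<Xi>\<^sub>T \<omega>)"
proof -
  interpret A: finite_measure_subalgebra M "F t" by (rule finite_measure_subalgebra_F[OF assms(1)])
  have [measurable]: "Z \<in> borel_measurable M" using F_measurable_imp_measurable assms by auto
  have "integrable M (\<lambda>\<omega>. Z \<omega> * \<Xi>\<^sub>T \<omega>)"
    using integrable_mult_of_squares[of Z M \<Xi>\<^sub>T] assms terminal_L2 by simp
  from A.real_cond_exp_intg(2)[OF this assms(2)]
  have "(LINT \<omega>|M. Z \<omega> * real_cond_exp M (F t) \<Xi>\<^sub>T \<omega>) = (LINT \<omega>|M. Z \<omega> * \<Xi>\<^sub>T \<omega>)" by simp
  moreover have "(LINT \<omega>|M. Z \<omega> * mart t \<omega>) = (LINT \<omega>|M. Z \<omega> * real_cond_exp M (F t) \<Xi>\<^sub>T \<omega>)"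
    by (rule integral_cong_AE) (use mart_AE[OF assms(1)] in auto)
  ultimately show ?thesis by simp
qed

text \<open>Pythagoras: the increment of the martingale from \<open>s\<close> to \<open>t\<close> is
  orthogonal to every square-integrable variable known at \<open>s\<close>. When both squares are
  expanded, the cross terms agree by \<open>cross_terminal\<close>.\<close>

lemma mean_square_dist:
  assumes "0 \<le> s" "s \<le> t" "t \<le> T" "Z \<in> borel_measurable (F s)" "integrable M (\<lambda>\<omega>. (Z \<omega>)\<^sup>2)"
  shows "(LINT \<omega>|M. (Z \<omega> - mart t \<omega>)\<^sup>2)
    = (LINT \<omega>|M. (Z \<omega> - mart s \<omega>)\<^sup>2) + (second_moment t - second_moment s)"
proof -
  have Zt: "Z \<in> borel_measurable (F t)"
    by (rule measurable_from_subalg[OF subalgebra_F_mono[OF assms(1-3)] assms(4)])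
  have [measurable]: "Z \<in> borel_measurable M"
    using F_measurable_imp_measurable[OF Zt] assms by auto
  have "(LINT \<omega>|M. Z \<omega> * mart t \<omega>) = (LINT \<omega>|M. Z \<omega> * mart s \<omega>)"
    using cross_terminal[of t Z] cross_terminal[of s Z] Zt assms by auto
  then show ?thesis
    using integrable_diff_squared(2)[of Z M "mart t"] integrable_diff_squared(2)[of Z M "mart s"] assms
    by (simp add: second_moment_def)
qed

lemma mart_increment:
  assumes "s \<le> t"
  shows "(LINT \<omega>|M. (mart s \<omega> - mart t \<omega>)\<^sup>2) = second_moment t - second_moment s"
proof -
  define s' t' where "s' = max 0 (min T s)" and "t' = max 0 (min T t)"
  have le: "0 \<le> s'" "s' \<le> t'" "t' \<le> T"
    using assms T_pos by (auto simp: s'_def t'_def)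
  have m: "mart s = mart s'" "mart t = mart t'"
    by (auto simp: mart_def s'_def t'_def fun_eq_iff)
  then have "second_moment s = second_moment s'" "second_moment t = second_moment t'"
    by (simp_all add: second_moment_def)
  then show ?thesis
    using mean_square_dist[OF le mart_measurable_F mart_L2] le by (simp add: m)
qed

lemma second_moment_mono: "s \<le> t \<Longrightarrow> second_moment s \<le> second_moment t"
  using mart_increment[of s t] integral_nonneg_AE[where M = M and f = "\<lambda>\<omega>. (mart s \<omega> - mart t \<omega>)\<^sup>2"] by simp

lemma mart_terminal: "AE \<omega> in M. mart T \<omega> = \<Xi>\<^sub>T \<omega>"
proof -
  interpret A: finite_measure_subalgebra M "F T"
    by (rule finite_measure_subalgebra_F) (use T_pos in auto)
  show ?thesis
    using mart_AE[of T] A.real_cond_exp_F_meas[OF terminal_integrable terminal_measurable] T_pos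
    by auto
qed

lemma mart_increment_nn:
  assumes "s \<le> t"
  shows "(\<integral>\<^sup>+\<omega>. ennreal ((mart s \<omega> - mart t \<omega>)\<^sup>2) \<partial>M) = ennreal (second_moment t - second_moment s)"
  using mart_increment[OF assms]
  by (subst nn_integral_eq_integral) (auto intro!: integrable_diff_squared)

lemma mart_right_continuous:
  assumes "\<omega> \<in> space M"
  shows "((\<lambda>s. mart s \<omega>) \<longlongrightarrow> mart t \<omega>) (at_right t)"
proof -
  consider "t < 0" | "t \<in> {0..<T}" | "t \<ge> T" by force
  then show ?thesis
  proof cases
    case 1
    have "\<forall>\<^sub>F s in at_right t. s < 0" by (rule eventually_at_rightI[where b=0]) (use 1 in auto)
    then have "\<forall>\<^sub>F s in at_right t. mart s \<omega> = mart t \<omega>"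
      by eventually_elim (use 1 T_pos in \<open>auto simp: mart_def max_def min_def\<close>)
    then show ?thesis by (rule tendsto_eventually)
  next
    case 2
    then have "((\<lambda>t. \<Xi> t \<omega>) \<longlongrightarrow> \<Xi> t \<omega>) (at_right t)"
      using cadlag_Xi assms by (auto simp: cadlag_cond_exp_def cadlag_on_def)
    moreover have "\<forall>\<^sub>F s in at_right t. \<Xi> s \<omega> = mart s \<omega>"
      by (rule eventually_at_rightI[where b=T]) (use 2 in \<open>auto simp: mart_def clamp_id\<close>)
    ultimately show ?thesis
      using 2 by (auto simp: mart_def[of t] clamp_id elim: Lim_transform_eventually)
  next
    case 3
    have "\<forall>\<^sub>F s in at_right t. mart s \<omega> = mart t \<omega>"
      by (rule eventually_at_rightI[where b="t+1"]) (use 3 in \<open>auto simp: mart_def\<close>)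
    then show ?thesis by (rule tendsto_eventually)
  qed
qed

lemma mart_jointly_measurable [measurable]: "(\<lambda>(t, \<omega>). mart t \<omega>) \<in> borel_measurable (borel \<Otimes>\<^sub>M M)"
  by (rule right_continuous_process_measurable[OF mart_measurable mart_right_continuous])

text \<open>Path continuity from the right is turned into continuity of the second moment by Fatou,
  applied to increments instead of values. It is needed for \<open>interval_measure\<close> to give
  intervals the expected mass.\<close>

lemma second_moment_right_continuous: "continuous (at_right t) second_moment"
proof -
  have mono: "second_moment y \<le> second_moment z" if "y \<le> z" for y z
    using second_moment_mono that .
  define s where "s n = t + inverse (real (Suc n))" for n
  have s_gt: "s n > t" for n by (simp add: s_def)
  have s_lim: "s \<longlonglongrightarrow> t"
    unfolding s_def using LIMSEQ_inverse_real_of_nat_add by simp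
  have dec: "decseq (\<lambda>n. second_moment (s n))"
    by (auto simp: decseq_def s_def intro!: mono le_imp_inverse_le)
  have "\<forall>n. second_moment t \<le> second_moment (s n)"
    using mono s_gt less_imp_le by blast
  from decseq_convergent[OF dec this] obtain c where
    c: "(\<lambda>n. second_moment (s n)) \<longlonglongrightarrow> c" "\<And>n. c \<le> second_moment (s n)" by blast
  have fr: "filterlim s (at_right t) sequentially"
    unfolding filterlim_at using s_lim s_gt by (auto simp: less_imp_neq[symmetric])
  \<comment> \<open>Fatou over \<open>k\<close> with \<open>n\<close> fixed: the increment from
    \<open>t\<close> to \<open>s n\<close> is the pathwise limit of those from \<open>s k\<close> to
    \<open>s n\<close>, whose mean squares tend to \<open>second_moment (s n) - c\<close>.\<close>
  have le: "second_moment (s n) - second_moment t \<le> second_moment (s n) - c" for n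
  proof -
    have "ennreal (second_moment (s n) - second_moment t)
        = (\<integral>\<^sup>+\<omega>. ennreal ((mart t \<omega> - mart (s n) \<omega>)\<^sup>2) \<partial>M)"
      using mart_increment_nn[of t "s n"] s_gt[of n] by simp
    also have "\<dots> = (\<integral>\<^sup>+\<omega>. liminf (\<lambda>k. ennreal ((mart (s k) \<omega> - mart (s n) \<omega>)\<^sup>2)) \<partial>M)"
    proof (rule nn_integral_cong)
      fix \<omega> assume "\<omega> \<in> space M"
      from filterlim_compose[OF mart_right_continuous[OF this] fr]
      have "(\<lambda>k. ennreal ((mart (s k) \<omega> - mart (s n) \<omega>)\<^sup>2)) \<longlonglongrightarrow> ennreal ((mart t \<omega> - mart (s n) \<omega>)\<^sup>2)"
        by (intro tendsto_intros)
      then show "ennreal ((mart t \<omega> - mart (s n) \<omega>)\<^sup>2) = liminf (\<lambda>k. ennreal ((mart (s k) \<omega> - mart (s n) \<omega>)\<^sup>2))"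
        by (rule lim_imp_Liminf[OF sequentially_bot, symmetric])
    qed
    also have "\<dots> \<le> liminf (\<lambda>k. \<integral>\<^sup>+\<omega>. ennreal ((mart (s k) \<omega> - mart (s n) \<omega>)\<^sup>2) \<partial>M)"
      by (rule nn_integral_liminf) measurable
    also have "\<dots> = ennreal (second_moment (s n) - c)"
    proof (rule lim_imp_Liminf[OF sequentially_bot])
      have "\<forall>\<^sub>F k in sequentially. ennreal (second_moment (s n) - second_moment (s k))
          = (\<integral>\<^sup>+\<omega>. ennreal ((mart (s k) \<omega> - mart (s n) \<omega>)\<^sup>2) \<partial>M)"
        using eventually_ge_at_top[of n]
      proof eventually_elim
        case (elim k)
        then have "s k \<le> s n" by (auto simp: s_def intro!: le_imp_inverse_le)
        then show ?case by (simp add: mart_increment_nn)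
      qed
      moreover have "(\<lambda>k. ennreal (second_moment (s n) - second_moment (s k))) \<longlonglongrightarrow> ennreal (second_moment (s n) - c)"
        by (intro tendsto_intros c)
      ultimately show "(\<lambda>k. \<integral>\<^sup>+\<omega>. ennreal ((mart (s k) \<omega> - mart (s n) \<omega>)\<^sup>2) \<partial>M) \<longlonglongrightarrow> ennreal (second_moment (s n) - c)"
        by (rule Lim_transform_eventually[rotated])
    qed
    finally show ?thesis using c(2)[of n] by simp
  qed
  \<comment> \<open>The limit \<open>c\<close> from the right lies above
    \<open>second_moment t\<close> by monotonicity; this is the nontrivial direction, and a single
    index already gives it.\<close>
  have "c \<le> second_moment t" using le[of 0] by simp
  have "(\<lambda>n. second_moment (s n)) \<longlonglongrightarrow> second_moment t"
  proof -
    have "second_moment t \<le> c"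
      by (rule LIMSEQ_le_const[OF c(1)]) (use mono s_gt less_imp_le in blast)
    with \<open>c \<le> second_moment t\<close> c(1) show ?thesis by simp
  qed
  show ?thesis
  proof (subst continuous_at_right_real_increasing[OF mono], assumption, safe)
    fix e :: real assume "e > 0"
    from LIMSEQ_D[OF \<open>(\<lambda>n. second_moment (s n)) \<longlonglongrightarrow> second_moment t\<close> this]
    obtain n where "norm (second_moment (s n) - second_moment t) < e" by blast
    then show "\<exists>d>0. second_moment (t + d) - second_moment t < e"
      by (intro exI[of _ "inverse (real (Suc n))"]) (auto simp: s_def)
  qed
qed

section \<open>The Stieltjes measure of the second moment\<close>

abbreviation "\<mu> \<equiv> second_moment_measure M T \<Xi>"

lemma second_moment_measure_Ioc:
  assumes "s \<le> t"
  shows "emeasure \<mu> {s<..t} = ennreal (second_moment t - second_moment s)"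
  unfolding second_moment_measure_def mart_def[symmetric] second_moment_def[symmetric]
  using assms second_moment_mono second_moment_right_continuous
  by (intro emeasure_interval_measure_Ioc)

lemma second_moment_measure_sets [measurable_cong, simp]: "sets \<mu> = sets borel"
  by (simp add: second_moment_measure_def)

text \<open>On \<open>{s<..t}\<close> the weight \<open>1 / (T - r)\<close> is at least
  \<open>1 / c\<close>, so the mass of the interval is dominated by \<open>c\<close> times its
  weighted mass. At \<open>r = T\<close> the weight is \<open>\<top>\<close> and the comparison is
  trivial.\<close>

lemma second_moment_increment_le:
  assumes "b \<le> s" "s \<le> t" "t \<le> T" "T - s \<le> c" "0 < c"
  shows "ennreal (second_moment t - second_moment s) \<le> ennreal c * (\<integral>\<^sup>+r\<in>{s<..t}. 1 / ennreal (T - r) \<partial>\<mu>)"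
proof -
  have "ennreal (second_moment t - second_moment s) = (\<integral>\<^sup>+r. indicator {s<..t} r \<partial>\<mu>)"
    using second_moment_measure_Ioc[OF assms(2)] by simp
  also have "\<dots> \<le> (\<integral>\<^sup>+r. ennreal c * (1 / ennreal (T - r) * indicator {s<..t} r) \<partial>\<mu>)"
  proof (rule nn_integral_mono)
    fix r
    have "1 \<le> ennreal c * (1 / ennreal (T - r))" if r: "r \<in> {s<..t}"
    proof -
      have "1 = ennreal c * (1 / ennreal c)"
        using assms(5) by (simp add: ennreal_times_divide ennreal_divide_self)
      also have "1 / ennreal c \<le> 1 / ennreal (T - r)"
      proof (cases "r = T")
        case False
        then have "r < T" using r assms(3) by auto
        moreover have "1 / c \<le> 1 / (T - r)"
          using r assms(4,5) \<open>r < T\<close> by (intro divide_left_mono) auto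
        moreover have "1 / ennreal c = ennreal (1 / c)" "1 / ennreal (T - r) = ennreal (1 / (T - r))"
          using divide_ennreal[of 1 c] divide_ennreal[of 1 "T - r"] assms(5) \<open>r < T\<close> by auto
        ultimately show ?thesis by (simp add: ennreal_leI)
      qed simp
      finally show ?thesis by (simp add: mult_left_mono)
    qed
    then show "indicator {s<..t} r \<le> ennreal c * (1 / ennreal (T - r) * indicator {s<..t} r)"
      by (auto simp: indicator_def)
  qed
  also have "\<dots> = ennreal c * (\<integral>\<^sup>+r\<in>{s<..t}. 1 / ennreal (T - r) \<partial>\<mu>)"
    by (rule nn_integral_cmult) measurable
  finally show ?thesis .
qed

end

section \<open>Moving averages\<close>

lemma progressive_cong:
  assumes "\<And>t \<omega>. t \<in> {0..T} \<Longrightarrow> X t \<omega> = Y t \<omega>"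
  shows "progressive T F X \<longleftrightarrow> progressive T F Y"
  unfolding progressive_def
proof (rule ball_cong[OF refl])
  fix t assume "t \<in> {0..T}"
  then show "(\<lambda>(s, \<omega>). X s \<omega>) \<in> borel_measurable (restrict_space borel {0..t} \<Otimes>\<^sub>M F t) \<longleftrightarrow>
    (\<lambda>(s, \<omega>). Y s \<omega>) \<in> borel_measurable (restrict_space borel {0..t} \<Otimes>\<^sub>M F t)"
    by (intro measurable_cong) (auto simp: space_pair_measure space_restrict_space intro!: assms)
qed

lemma progressive_adapted:
  assumes "progressive T F X" "t \<in> {0..T}"
  shows "X t \<in> borel_measurable (F t)"
proof -
  have "(\<lambda>\<omega>. (t, \<omega>)) \<in> F t \<rightarrow>\<^sub>M restrict_space borel {0..t} \<Otimes>\<^sub>M F t"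
    using assms(2) by (intro measurable_Pair) (auto simp: space_restrict_space)
  from measurable_compose[OF this, of "\<lambda>(s, \<omega>). X s \<omega>" borel] assms
  show ?thesis by (simp add: progressive_def)
qed

lemma set_integrable_const_Icc: "set_integrable lborel {a..b::real} (\<lambda>_. c :: real)"
  unfolding set_integrable_def
  by (cases "a \<le> b") (auto intro!: integrable_mult_left integrable_real_indicator)

lemma set_integral_const_Icc: "a \<le> b \<Longrightarrow> (LINT s:{a..b}|lborel. c) = (b - a) * (c :: real)" for a b :: real
  unfolding set_lebesgue_integral_def by simp

lemma set_integral_Icc_split:
  fixes f :: "real \<Rightarrow> real"
  assumes "set_integrable lborel {a..c} f" "a \<le> b" "b \<le> c"
  shows "(LINT s:{a..c}|lborel. f s) = (LINT s:{a..b}|lborel. f s) + (LINT s:{b<..c}|lborel. f s)"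
    and "(LINT s:{b<..c}|lborel. f s) = (LINT s:{b..c}|lborel. f s)"
proof -
  have "{a..c} = {a..b} \<union> {b<..c}" using assms(2,3) by auto
  moreover have "(LINT s:{a..b} \<union> {b<..c}|lborel. f s) = (LINT s:{a..b}|lborel. f s) + (LINT s:{b<..c}|lborel. f s)"
    by (rule set_integral_Un) (use assms(2,3) in \<open>auto intro!: set_integrable_subset[OF assms(1)]\<close>)
  ultimately show "(LINT s:{a..c}|lborel. f s) = (LINT s:{a..b}|lborel. f s) + (LINT s:{b<..c}|lborel. f s)"
    by simp
  have m: "set_borel_measurable lborel {a..c} f"
    using assms(1) by (auto simp: set_integrable_def set_borel_measurable_def)
  have "AE s in lborel. s \<noteq> b" by (rule AE_lborel_singleton)
  then have "AE s in lborel. s \<in> {b<..c} \<longleftrightarrow> s \<in> {b..c}" by eventually_elim auto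
  then show "(LINT s:{b<..c}|lborel. f s) = (LINT s:{b..c}|lborel. f s)"
    by (intro set_integral_cong_set set_borel_measurable_subset[OF m]) (use assms in auto)
qed

text \<open>Uses \<open>|g| \<le> 1 + g^2\<close>, constants being integrable on a bounded
  interval.\<close>

lemma set_integrable_of_square:
  fixes g :: "real \<Rightarrow> real"
  assumes [measurable]: "g \<in> borel_measurable borel"
    and "(\<integral>\<^sup>+s\<in>{a..b}. ennreal ((g s)\<^sup>2) \<partial>lborel) < \<top>"
  shows "set_integrable lborel {a..b} (\<lambda>s. (g s)\<^sup>2)" "set_integrable lborel {a..b} g"
proof -
  have "(\<integral>\<^sup>+s. ennreal (indicator {a..b} s *\<^sub>R (g s)\<^sup>2) \<partial>lborel) = (\<integral>\<^sup>+s\<in>{a..b}. ennreal ((g s)\<^sup>2) \<partial>lborel)"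
    by (intro nn_integral_cong) (auto simp: indicator_def)
  then show 1: "set_integrable lborel {a..b} (\<lambda>s. (g s)\<^sup>2)"
    using assms(2) unfolding set_integrable_def
    by (intro integrableI_nonneg) auto
  have "set_integrable lborel {a..b} (\<lambda>s. 1 + (g s)\<^sup>2)"
    by (intro set_integral_add(1) set_integrable_const_Icc 1)
  then show "set_integrable lborel {a..b} g"
  proof (rule set_integrable_bound)
    show "set_borel_measurable lborel {a..b} g" by (simp add: set_borel_measurable_def)
    have "\<bar>g s\<bar> \<le> 1 + (g s)\<^sup>2" for s
      using sum_squares_bound[of "\<bar>g s\<bar>" 1] by (auto simp: power2_abs intro: order_trans[of _ "2 * \<bar>g s\<bar>"])
    then show "AE s in lborel. s \<in> {a..b} \<longrightarrow> norm (g s) \<le> norm (1 + (g s)\<^sup>2)"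
      by (auto intro!: AE_I2 intro: order_trans[OF _ abs_ge_self])
  qed
qed

text \<open>Jensen for the uniform distribution on \<open>{0..a}\<close>, obtained from the
  nonnegative integral of the squared deviation from the mean. If the square integral is infinite,
  the right side is \<open>\<top>\<close>.\<close>

lemma mean_square_le:
  fixes g :: "real \<Rightarrow> real"
  assumes [measurable]: "g \<in> borel_measurable borel" and a: "a > 0"
  shows "ennreal (((LINT r:{0..a}|lborel. g r) / a)\<^sup>2) \<le> ennreal (1 / a) * (\<integral>\<^sup>+r\<in>{0..a}. ennreal ((g r)\<^sup>2) \<partial>lborel)"
proof (cases "(\<integral>\<^sup>+r\<in>{0..a}. ennreal ((g r)\<^sup>2) \<partial>lborel) < \<top>")
  case True
  note i = set_integrable_of_square[OF assms(1) True]
  define c where "c = (LINT r:{0..a}|lborel. g r) / a"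
  define q where "q = (LINT r:{0..a}|lborel. (g r)\<^sup>2)"
  have "0 \<le> (LINT r:{0..a}|lborel. (g r - c)\<^sup>2)"
    unfolding set_lebesgue_integral_def by (intro integral_nonneg_AE) auto
  also have "\<dots> = (LINT r:{0..a}|lborel. (g r)\<^sup>2 - 2 * c * g r + c\<^sup>2)"
    by (simp add: power2_diff algebra_simps)
  also have "\<dots> = q - 2 * c * (c * a) + c\<^sup>2 * a"
  proof -
    have g: "set_integrable lborel {0..a} (\<lambda>r. 2 * c * g r)" "set_integrable lborel {0..a} (\<lambda>r. c\<^sup>2)"
      using set_integrable_mult_right[OF i(2), of "2 * c"] set_integrable_const_Icc by auto
    have "(LINT r:{0..a}|lborel. g r) = c * a" using a by (simp add: c_def)
    moreover have "(LINT r:{0..a}|lborel. c\<^sup>2) = c\<^sup>2 * a" using a by (simp add: set_integral_const_Icc)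
    moreover have "(LINT r:{0..a}|lborel. 2 * c * g r) = 2 * c * (LINT r:{0..a}|lborel. g r)"
      by (rule set_integral_mult_right)
    ultimately show ?thesis
      using set_integral_add(2)[OF set_integral_diff(1)[OF i(1) g(1)] g(2)] set_integral_diff(2)[OF i(1) g(1)]
      by (simp add: q_def)
  qed
  finally have "c\<^sup>2 * a \<le> q" by (simp add: power2_eq_square algebra_simps)
  then have "c\<^sup>2 \<le> 1 / a * q" using a by (simp add: field_simps)
  moreover have "(\<integral>\<^sup>+r\<in>{0..a}. ennreal ((g r)\<^sup>2) \<partial>lborel) = ennreal q"
  proof -
    have "(\<integral>\<^sup>+r\<in>{0..a}. ennreal ((g r)\<^sup>2) \<partial>lborel) = (\<integral>\<^sup>+r. ennreal (indicator {0..a} r *\<^sub>R (g r)\<^sup>2) \<partial>lborel)"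
      by (intro nn_integral_cong) (auto simp: indicator_def)
    also have "\<dots> = ennreal q"
      unfolding q_def set_lebesgue_integral_def
      by (intro nn_integral_eq_integral i(1)[unfolded set_integrable_def]) auto
    finally show ?thesis .
  qed
  ultimately show ?thesis
    using a unfolding c_def[symmetric] by (simp add: ennreal_mult'[symmetric] ennreal_leI)
next
  case False
  then have "(\<integral>\<^sup>+r\<in>{0..a}. ennreal ((g r)\<^sup>2) \<partial>lborel) = \<top>" using less_top by blast
  then show ?thesis using a by (simp add: ennreal_mult_top)
qed

text \<open>Integrating the difference quotient \<open>(p s - p (s - a)) / a\<close> telescopes to the moving average of
  \<open>p\<close> over the last \<open>a\<close> time units; the jump term corrects the initial value.\<close>

lemma moving_average:
  fixes p :: "real \<Rightarrow> real"
  assumes [measurable]: "p \<in> borel_measurable borel" and a: "a > 0" and t: "t \<ge> 0"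
    and int: "set_integrable lborel {0..t} p" and const: "\<And>s. s \<le> 0 \<Longrightarrow> p s = p 0"
  shows "x + (LINT s:{0..t}|lborel. (p s - p (s - a) + indicator {0..<a} s * (p 0 - x)) / a) =
    (LINT r:{0..a}|lborel. p (t - r)) / a + max 0 (1 - t / a) * (x - p 0)"
    and "set_integrable lborel {0..a} (\<lambda>r. p (t - r))"
proof -
  have "set_integrable lborel {-a..0} (\<lambda>s. p 0)"
    by (rule set_integrable_const_Icc)
  then have i0: "set_integrable lborel {-a..0} p"
    by (subst set_integrable_cong[OF refl refl, of _ _ "\<lambda>s. p 0"]) (auto intro: const)
  have "set_integrable lborel ({-a..0} \<union> {0..t}) p"
    using i0 int by (rule set_integrable_Un) auto
  moreover have "{-a..0} \<union> {0..t} = {-a..t}" using a t by auto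
  ultimately have i: "set_integrable lborel {-a..t} p" by simp
  have shift: "set_integrable lborel {0..t} (\<lambda>s. p (s - a))"
    "(LINT s:{0..t}|lborel. p (s - a)) = (LINT s:{-a..t-a}|lborel. p s)"
  proof -
    have *: "indicator {-a..t-a} (-a + 1 * s) *\<^sub>R p (-a + 1 * s) = indicator {0..t} s *\<^sub>R p (s - a)" for s
      by (auto simp: indicator_def)
    have "set_integrable lborel {-a..t-a} p"
      using i by (rule set_integrable_subset) (use a in auto)
    then have "integrable lborel (\<lambda>s. indicator {-a..t-a} (-a + 1 * s) *\<^sub>R p (-a + 1 * s))"
      unfolding set_integrable_def by (rule lborel_integrable_real_affine) simp
    then show "set_integrable lborel {0..t} (\<lambda>s. p (s - a))"
      unfolding * set_integrable_def .
    have "(LINT s:{-a..t-a}|lborel. p s) = (LINT s|lborel. indicator {-a..t-a} (-a + 1 * s) *\<^sub>R p (-a + 1 * s))"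
      unfolding set_lebesgue_integral_def by (subst lborel_integral_real_affine[of 1 _ "-a"]) auto
    then show "(LINT s:{0..t}|lborel. p (s - a)) = (LINT s:{-a..t-a}|lborel. p s)"
      unfolding * set_lebesgue_integral_def by simp
  qed
  have reflect: "set_integrable lborel {0..a} (\<lambda>r. p (t - r))"
    "(LINT r:{0..a}|lborel. p (t - r)) = (LINT s:{t-a..t}|lborel. p s)"
  proof -
    have *: "indicator {t-a..t} (t + (-1) * s) *\<^sub>R p (t + (-1) * s) = indicator {0..a} s *\<^sub>R p (t - s)" for s
      by (auto simp: indicator_def)
    have "set_integrable lborel {t-a..t} p"
      using i by (rule set_integrable_subset) (use t in auto)
    then have "integrable lborel (\<lambda>s. indicator {t-a..t} (t + (-1) * s) *\<^sub>R p (t + (-1) * s))"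
      unfolding set_integrable_def by (rule lborel_integrable_real_affine) simp
    then show "set_integrable lborel {0..a} (\<lambda>r. p (t - r))"
      unfolding * set_integrable_def .
    have "(LINT s:{t-a..t}|lborel. p s) = (LINT s|lborel. indicator {t-a..t} (t + (-1) * s) *\<^sub>R p (t + (-1) * s))"
      unfolding set_lebesgue_integral_def by (subst lborel_integral_real_affine[of "-1" _ t]) auto
    then show "(LINT r:{0..a}|lborel. p (t - r)) = (LINT s:{t-a..t}|lborel. p s)"
      unfolding * set_lebesgue_integral_def by simp
  qed
  show "set_integrable lborel {0..a} (\<lambda>r. p (t - r))" by (rule reflect(1))
  have "(LINT s:{-a..0}|lborel. p s) = (LINT s:{-a..0}|lborel. p 0)"
    by (rule set_lebesgue_integral_cong) (auto intro: const)
  then have c0: "(LINT s:{-a..0}|lborel. p s) = a * p 0"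
    using a by (simp add: set_integral_const_Icc)
  \<comment> \<open>Both integrals are completed to the integral over \<open>{-a..t}\<close>, so the
    overlap cancels for \<open>t \<le> a\<close> and \<open>t > a\<close> alike. What remains of the
    past is the constant piece on \<open>{-a..0}\<close>, worth \<open>a * p 0\<close>.\<close>
  have split: "(LINT s:{0..t}|lborel. p s) - (LINT s:{-a..t-a}|lborel. p s) = (LINT s:{t-a..t}|lborel. p s) - a * p 0"
    using set_integral_Icc_split[OF i, of 0] set_integral_Icc_split[OF i, of "t - a"] a t c0 by simp
  have ji: "set_integrable lborel {0..t} (\<lambda>s. indicator {0..<a} s * (p 0 - x))"
  proof -
    have "emeasure lborel ({0..t} \<inter> {0..<a}) \<le> emeasure lborel {0..t}" by (rule emeasure_mono) auto
    also have "\<dots> < \<infinity>" using t by simp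
    finally have fin: "emeasure lborel ({0..t} \<inter> {0..<a}) < \<infinity>" .
    have "integrable lborel (\<lambda>s. indicator ({0..t} \<inter> {0..<a}) s *\<^sub>R (p 0 - x))"
      by (intro integrable_scaleR_left integrable_real_indicator)
         (use fin in auto)
    also have "(\<lambda>s. indicator ({0..t} \<inter> {0..<a}) s *\<^sub>R (p 0 - x)) =
      (\<lambda>s. indicator {0..t} s *\<^sub>R (indicator {0..<a} s * (p 0 - x)))"
      by (intro ext) (simp add: indicator_inter_arith)
    finally show ?thesis unfolding set_integrable_def .
  qed
  have jump: "(LINT s:{0..t}|lborel. indicator {0..<a} s * (p 0 - x)) = min t a * (p 0 - x)"
  proof -
    have "(LINT s:{0..t}|lborel. indicator {0..<a} s * (p 0 - x)) = (LINT s|lborel. indicator ({0..t} \<inter> {0..<a}) s *\<^sub>R (p 0 - x))"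
      unfolding set_lebesgue_integral_def by (intro Bochner_Integration.integral_cong) (auto simp: indicator_def)
    also have "\<dots> = measure lborel ({0..t} \<inter> {0..<a}) * (p 0 - x)"
      by simp
    also have "{0..t} \<inter> {0..<a} = (if t < a then {0..t} else {0..<a})" by auto
    also have "measure lborel (if t < a then {0..t} else {0..<a}) = min t a"
      using a t by (cases "t < a") auto
    finally show ?thesis .
  qed
  have "(LINT s:{0..t}|lborel. (p s - p (s - a) + indicator {0..<a} s * (p 0 - x)) / a) =
      ((LINT s:{0..t}|lborel. p s) - (LINT s:{0..t}|lborel. p (s - a)) + min t a * (p 0 - x)) / a"
    using int shift(1) ji jump by (simp add: set_integral_add set_integral_diff)
  also have "\<dots> = ((LINT r:{0..a}|lborel. p (t - r)) - a * p 0 + min t a * (p 0 - x)) / a"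
    using split shift(2) reflect(2) by simp
  finally have eq: "(LINT s:{0..t}|lborel. (p s - p (s - a) + indicator {0..<a} s * (p 0 - x)) / a) =
      ((LINT r:{0..a}|lborel. p (t - r)) - a * p 0 + min t a * (p 0 - x)) / a" .
  \<comment> \<open>The ramp is \<open>1 - min t a / a\<close>: the initial error is removed at
    constant speed during the first \<open>a\<close> time units.\<close>
  show "x + (LINT s:{0..t}|lborel. (p s - p (s - a) + indicator {0..<a} s * (p 0 - x)) / a) =
    (LINT r:{0..a}|lborel. p (t - r)) / a + max 0 (1 - t / a) * (x - p 0)"
    unfolding eq using a by (cases "t \<le> a") (auto simp: field_simps)
qed

lemma power2_sum_le: "(y + z)\<^sup>2 \<le> 2 * y\<^sup>2 + 2 * z\<^sup>2" for y z :: real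
  using zero_le_power2[of "y - z"] by (simp add: power2_sum power2_diff)

section \<open>The filter control\<close>

lemma (in sigma_finite_measure) nn_integral_time_swap:
  assumes f: "(\<lambda>(t, \<omega>). f t \<omega>) \<in> borel_measurable (borel \<Otimes>\<^sub>M M)" and A: "A \<in> sets borel"
  shows "(\<integral>\<^sup>+\<omega>. (\<integral>\<^sup>+t\<in>A. f t \<omega> \<partial>lborel) \<partial>M) = (\<integral>\<^sup>+t\<in>A. (\<integral>\<^sup>+\<omega>. f t \<omega> \<partial>M) \<partial>(lborel :: real measure))"
proof -
  interpret P: pair_sigma_finite lborel M ..
  note f[measurable] A[measurable]
  have "(\<lambda>(t, \<omega>). f t \<omega> * indicator A t) \<in> borel_measurable (lborel \<Otimes>\<^sub>M M)"
    unfolding split_beta' by measurable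
  from P.Fubini'[OF this]
  have "(\<integral>\<^sup>+\<omega>. (\<integral>\<^sup>+t. f t \<omega> * indicator A t \<partial>lborel) \<partial>M) = (\<integral>\<^sup>+t. (\<integral>\<^sup>+\<omega>. f t \<omega> * indicator A t \<partial>M) \<partial>lborel)" .
  also have "\<dots> = (\<integral>\<^sup>+t\<in>A. (\<integral>\<^sup>+\<omega>. f t \<omega> \<partial>M) \<partial>lborel)"
  proof (rule nn_integral_cong)
    fix t :: real
    have "(\<lambda>\<omega>. f t \<omega>) \<in> borel_measurable M" by measurable
    then show "(\<integral>\<^sup>+\<omega>. f t \<omega> * indicator A t \<partial>M) = (\<integral>\<^sup>+\<omega>. f t \<omega> \<partial>M) * indicator A t"
      by (rule nn_integral_multc)
  qed
  finally show ?thesis .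
qed

lemma (in sigma_finite_measure) time_energy_swap:
  assumes "(\<lambda>(t, \<omega>). Y t \<omega>) \<in> borel_measurable (borel \<Otimes>\<^sub>M M)"
  shows "time_energy M b c Y = (\<integral>\<^sup>+t\<in>{b..c}. (\<integral>\<^sup>+\<omega>. ennreal ((Y t \<omega>)\<^sup>2) \<partial>M) \<partial>lborel)"
  unfolding time_energy_def
  by (rule nn_integral_time_swap) (use assms in measurable)

lemma time_energy_cong:
  assumes "\<And>t \<omega>. t \<in> {b..c} \<Longrightarrow> Y t \<omega> = Z t \<omega>"
  shows "time_energy M b c Y = time_energy M b c Z"
  unfolding time_energy_def
  by (intro nn_integral_cong) (auto simp: indicator_def assms)

text \<open>The integral in \<open>state\<close> defaults to 0 on paths that are not integrable.
  This confines such paths to a null set, so that path integrals may be split and shifted.\<close>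

lemma time_energy_finite_AE:
  assumes "time_energy M b c Y < \<top>" "(\<lambda>(t, \<omega>). Y t \<omega>) \<in> borel_measurable (borel \<Otimes>\<^sub>M M)"
  shows "AE \<omega> in M. set_integrable lborel {b..c} (\<lambda>t. Y t \<omega>)"
proof -
  note assms(2)[measurable]
  have "(\<lambda>\<omega>. \<integral>\<^sup>+t\<in>{b..c}. ennreal ((Y t \<omega>)\<^sup>2) \<partial>lborel) \<in> borel_measurable M"
    by measurable
  with assms(1) have "AE \<omega> in M. (\<integral>\<^sup>+t\<in>{b..c}. ennreal ((Y t \<omega>)\<^sup>2) \<partial>lborel) \<noteq> \<infinity>"
    unfolding time_energy_def by (intro nn_integral_PInf_AE) auto
  then show ?thesis
    using AE_space
  proof eventually_elim
    case (elim \<omega>)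
    have "(\<lambda>t. Y t \<omega>) \<in> borel_measurable borel"
      using measurable_compose[OF measurable_Pair[OF measurable_ident measurable_const[OF elim(2)]] assms(2)]
      by (simp add: id_def)
    then show ?case
      using elim(1) by (intro set_integrable_of_square(2)) (auto simp: less_top)
  qed
qed

context tracking_problem
begin

definition initial_gap :: ennreal where
  "initial_gap = (\<integral>\<^sup>+\<omega>. ennreal ((x - \<xi> 0 \<omega>)\<^sup>2) \<partial>M)"

abbreviation "seminorm \<equiv> transl_seminorm_sq M T \<xi>"

text \<open>The formal time derivative of the moving average of \<open>target\<close> over the last
  \<open>a\<close> time units plus the ramp
  \<open>max 0 (1 - t / a) * (x - target 0)\<close>.\<close>

definition warmup :: "real \<Rightarrow> real \<Rightarrow> 'a \<Rightarrow> real" where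
  "warmup a t \<omega> = (target t \<omega> - target (t - a) \<omega> + indicator {0..<a} t * (target 0 \<omega> - x)) / a"

lemma target_zero: "target 0 = \<xi> 0"
  using T_pos by (auto simp: target_def fun_eq_iff)

lemma target_jointly_measurable [measurable]:
  "(\<lambda>(t, \<omega>). target t \<omega>) \<in> borel_measurable (borel \<Otimes>\<^sub>M M)"
  unfolding target_def using T_pos
  by (intro progressive_clamped_measurable(2)[OF progressive_xi _ subalgebra_F]) auto

lemma target_path_measurable: "\<omega> \<in> space M \<Longrightarrow> (\<lambda>t. target t \<omega>) \<in> borel_measurable borel"
  using measurable_compose[OF measurable_Pair[OF measurable_ident measurable_const] target_jointly_measurable]
  by (simp add: id_def)

lemma progressive_target: "progressive T F target"
  using progressive_xi by (subst progressive_cong[where Y = \<xi>]) (auto simp: target_def clamp_id)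

lemma progressive_warmup:
  assumes "a > 0"
  shows "progressive T F (warmup a)"
proof -
  have "progressive T F (\<lambda>t \<omega>. target (max (t - a) 0) \<omega>)"
    by (rule progressive_delay[OF progressive_target]) (use assms in auto)
  then have 1: "progressive T F (\<lambda>t \<omega>. target (t - a) \<omega>)"
    by (rule progressive_cong[THEN iffD1, rotated]) (use T_pos in \<open>auto simp: target_def max_def min_def\<close>)
  have "(\<lambda>\<omega>. target 0 \<omega> - x) \<in> borel_measurable (F 0)"
    using progressive_adapted[OF progressive_target, of 0] T_pos by simp
  then have 2: "progressive T F (\<lambda>t \<omega>. indicator {0..<a} t * (target 0 \<omega> - x))"
    by (rule progressive_after) (auto intro: subalgebra_F_mono)
  have "progressive T F (\<lambda>t \<omega>. (1 / a) * ((target t \<omega> + (-1) * target (t - a) \<omega>) + indicator {0..<a} t * (target 0 \<omega> - x)))"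
    by (intro progressive_add progressive_cmult progressive_target 1 2)
  then show ?thesis by (simp add: warmup_def[abs_def])
qed

lemma warmup_jointly_measurable [measurable]:
  "(\<lambda>(t, \<omega>). warmup a t \<omega>) \<in> borel_measurable (borel \<Otimes>\<^sub>M M)"
  unfolding warmup_def by measurable

lemma transl_modulus_eq:
  "transl_modulus M T \<xi> h = (\<integral>\<^sup>+t\<in>{0..T}. (\<integral>\<^sup>+\<omega>. ennreal ((target t \<omega> - target (t - h) \<omega>)\<^sup>2) \<partial>M) \<partial>lborel)"
  if "h > 0"
proof -
  have "transl_modulus M T \<xi> h = time_energy M 0 T (\<lambda>t \<omega>. target t \<omega> - target (t - h) \<omega>)"
    unfolding transl_modulus_def using that
    by (intro time_energy_cong) (auto simp: target_def max_def min_def)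
  then show ?thesis by (subst (asm) time_energy_swap) auto
qed

lemma transl_modulus_le:
  assumes "h > 0"
  shows "transl_modulus M T \<xi> h \<le> ennreal h * seminorm"
proof -
  have "transl_modulus M T \<xi> h / ennreal h \<le> seminorm"
    unfolding transl_seminorm_sq_def by (rule SUP_upper) (use assms in auto)
  then have "ennreal h * (transl_modulus M T \<xi> h / ennreal h) \<le> ennreal h * seminorm"
    by (rule mult_left_mono) simp
  moreover have "ennreal h * (transl_modulus M T \<xi> h / ennreal h) = transl_modulus M T \<xi> h"
    using assms by (subst mult.commute, subst ennreal_divide_times) (simp add: ennreal_divide_self)
  ultimately show ?thesis by simp
qed

lemma initial_gap_eq: "initial_gap = (\<integral>\<^sup>+\<omega>. ennreal ((target 0 \<omega> - x)\<^sup>2) \<partial>M)"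
  by (simp add: initial_gap_def target_zero power2_commute)

text \<open>The numerator of \<open>warmup\<close> is a translation increment, of integrated square
  at most \<open>a\<close> times the seminorm, plus a jump term that lives for time at most
  \<open>a\<close>; the 2 comes from squaring a sum. The weight \<open>a^2\<close> is the later
  value of \<open>\<kappa>\<close>.\<close>

lemma warmup_energy:
  assumes "a > 0"
  shows "ennreal (a\<^sup>2) * (\<integral>\<^sup>+t\<in>{0..T}. (\<integral>\<^sup>+\<omega>. ennreal ((warmup a t \<omega>)\<^sup>2) \<partial>M) \<partial>lborel)
    \<le> ennreal (2 * a) * (seminorm + initial_gap)"
proof -
  have ptw: "ennreal (a\<^sup>2) * ennreal ((warmup a t \<omega>)\<^sup>2) \<le>
      2 * ennreal ((target t \<omega> - target (t - a) \<omega>)\<^sup>2) + indicator {0..<a} t * (2 * ennreal ((target 0 \<omega> - x)\<^sup>2))" for t \<omega>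
  proof -
    have "a\<^sup>2 * (warmup a t \<omega>)\<^sup>2 = (target t \<omega> - target (t - a) \<omega> + indicator {0..<a} t * (target 0 \<omega> - x))\<^sup>2"
      using assms by (simp add: warmup_def power_divide)
    also have "\<dots> \<le> 2 * (target t \<omega> - target (t - a) \<omega>)\<^sup>2 + 2 * (indicator {0..<a} t * (target 0 \<omega> - x))\<^sup>2"
      by (rule power2_sum_le)
    also have "\<dots> = 2 * (target t \<omega> - target (t - a) \<omega>)\<^sup>2 + indicator {0..<a} t * (2 * (target 0 \<omega> - x)\<^sup>2)"
      by (auto simp: indicator_def)
    finally have "ennreal (a\<^sup>2 * (warmup a t \<omega>)\<^sup>2) \<le>
      ennreal (2 * (target t \<omega> - target (t - a) \<omega>)\<^sup>2 + indicator {0..<a} t * (2 * (target 0 \<omega> - x)\<^sup>2))"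
      by (rule ennreal_leI)
    then show ?thesis
      by (simp add: ennreal_mult' ennreal_plus[symmetric] ennreal_indicator[symmetric] indicator_def split: if_splits)
  qed
  have "ennreal (a\<^sup>2) * (\<integral>\<^sup>+t\<in>{0..T}. (\<integral>\<^sup>+\<omega>. ennreal ((warmup a t \<omega>)\<^sup>2) \<partial>M) \<partial>lborel)
      = (\<integral>\<^sup>+t\<in>{0..T}. (\<integral>\<^sup>+\<omega>. ennreal (a\<^sup>2) * ennreal ((warmup a t \<omega>)\<^sup>2) \<partial>M) \<partial>lborel)"
    by (subst nn_integral_cmult[symmetric]) (auto simp: nn_integral_cmult mult.assoc)
  also have "\<dots> \<le> (\<integral>\<^sup>+t\<in>{0..T}. (\<integral>\<^sup>+\<omega>. 2 * ennreal ((target t \<omega> - target (t - a) \<omega>)\<^sup>2) +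
        indicator {0..<a} t * (2 * ennreal ((target 0 \<omega> - x)\<^sup>2)) \<partial>M) \<partial>lborel)"
    by (intro nn_integral_mono mult_right_mono ptw) auto
  also have "\<dots> = (\<integral>\<^sup>+t. 2 * ((\<integral>\<^sup>+\<omega>. ennreal ((target t \<omega> - target (t - a) \<omega>)\<^sup>2) \<partial>M) * indicator {0..T} t) +
        2 * initial_gap * indicator ({0..<a} \<inter> {0..T}) t \<partial>lborel)"
    unfolding initial_gap_eq
    by (intro nn_integral_cong, subst nn_integral_add)
       (auto simp: nn_integral_cmult indicator_def)
  also have "\<dots> = 2 * transl_modulus M T \<xi> a + 2 * initial_gap * emeasure lborel ({0..<a} \<inter> {0..T})"
    unfolding transl_modulus_eq[OF assms]
    by (subst nn_integral_add) (auto simp: nn_integral_cmult)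
  also have "\<dots> \<le> 2 * (ennreal a * seminorm) + 2 * initial_gap * emeasure lborel {0..<a}"
    by (intro add_mono mult_left_mono transl_modulus_le assms emeasure_mono) auto
  also have "\<dots> = ennreal (2 * a) * (seminorm + initial_gap)"
    using assms by (simp add: ennreal_mult' algebra_simps)
  finally show ?thesis .
qed

text \<open>Written so that the tracking error is an average of translation increments, which the
  seminorm controls, plus the ramp. One null set serves all times.\<close>

lemma warmup_state:
  "AE \<omega> in M. \<forall>t\<in>{0..T}. state x (warmup a) t \<omega> - target t \<omega>
     = (LINT r:{0..a}|lborel. target (t - r) \<omega> - target t \<omega>) / a + max 0 (1 - t / a) * (x - target 0 \<omega>)"
  if a: "a > 0"
proof -
  have "time_energy M 0 T target < \<top>"
    using xi_energy by (subst time_energy_cong[where Z = \<xi>]) (auto simp: target_def clamp_id)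
  from time_energy_finite_AE[OF this target_jointly_measurable] AE_space
  show ?thesis
  proof eventually_elim
    case (elim \<omega>)
    show ?case
    proof
      fix t assume t: "t \<in> {0..T}"
      have i: "set_integrable lborel {0..t} (\<lambda>t. target t \<omega>)"
        by (rule set_integrable_subset[OF elim(1)]) (use t in auto)
      have c: "target s \<omega> = target 0 \<omega>" if "s \<le> 0" for s
        using that by (auto simp: target_def max_def min_def)
      note mv = moving_average(1)[OF target_path_measurable[OF elim(2)] a _ i c, of x]
        moving_average(2)[OF target_path_measurable[OF elim(2)] a _ i c]
      have "state x (warmup a) t \<omega> = (LINT r:{0..a}|lborel. target (t - r) \<omega>) / a + max 0 (1 - t / a) * (x - target 0 \<omega>)"
        using mv(1) t by (simp add: state_def warmup_def)
      moreover have "(LINT r:{0..a}|lborel. target (t - r) \<omega> - target t \<omega>) = (LINT r:{0..a}|lborel. target (t - r) \<omega>) - a * target t \<omega>"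
        using set_integral_diff(2)[OF mv(2) set_integrable_const_Icc] t a by (simp add: set_integral_const_Icc)
      ultimately show "state x (warmup a) t \<omega> - target t \<omega>
        = (LINT r:{0..a}|lborel. target (t - r) \<omega> - target t \<omega>) / a + max 0 (1 - t / a) * (x - target 0 \<omega>)"
        using a by (simp add: field_simps)
    qed
  qed
qed

text \<open>The right side is the area of a triangle with base \<open>a\<close> and height
  1.\<close>

lemma ramp_integral:
  assumes "a > 0"
  shows "(\<integral>\<^sup>+t\<in>{0..T}. ennreal (max 0 (1 - t / a)) \<partial>lborel) \<le> ennreal (a / 2)"
proof -
  have "(\<integral>\<^sup>+t\<in>{0..T}. ennreal (max 0 (1 - t / a)) \<partial>lborel) \<le> (\<integral>\<^sup>+t\<in>{0..a}. ennreal (1 - t / a) \<partial>lborel)"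
    using assms by (intro nn_integral_mono) (auto simp: indicator_def max_def field_simps)
  also have "\<dots> = ennreal ((a - a\<^sup>2 / (2 * a)) - (0 - 0\<^sup>2 / (2 * a)))"
    by (rule nn_integral_FTC_Icc) (use assms in \<open>auto intro!: derivative_eq_intros\<close>)
  also have "\<dots> = ennreal (a / 2)"
    using assms by (simp add: power2_eq_square)
  finally show ?thesis .
qed

text \<open>Jensen moves the square inside the average over the shift \<open>r\<close>; after
  exchanging \<open>t\<close> and \<open>r\<close>, each shift \<open>r \<le> a\<close> costs at
  most \<open>a * seminorm\<close>. The prefactor \<open>2 / a\<close> and the length
  \<open>a\<close> of the shift range give \<open>2 * a * seminorm\<close>; the ramp contributes
  \<open>2 * (a / 2)\<close> times the initial gap.\<close>

lemma warmup_tracking: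
  assumes a: "a > 0"
  shows "(\<integral>\<^sup>+t\<in>{0..T}. (\<integral>\<^sup>+\<omega>. ennreal ((state x (warmup a) t \<omega> - target t \<omega>)\<^sup>2) \<partial>M) \<partial>lborel)
    \<le> ennreal a * (2 * seminorm + initial_gap)"
proof -
  define G where "G t r = (\<integral>\<^sup>+\<omega>. ennreal ((target t \<omega> - target (t - r) \<omega>)\<^sup>2) \<partial>M)" for t r
  have G_meas [measurable]: "(\<lambda>(t, r). G t r) \<in> borel_measurable (borel \<Otimes>\<^sub>M borel)"
    unfolding G_def split_beta' by measurable
  have ptw: "(\<integral>\<^sup>+\<omega>. ennreal ((state x (warmup a) t \<omega> - target t \<omega>)\<^sup>2) \<partial>M)
    \<le> ennreal (2 / a) * (\<integral>\<^sup>+r\<in>{0..a}. G t r \<partial>lborel) + ennreal (2 * max 0 (1 - t / a)) * initial_gap"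
    if t: "t \<in> {0..T}" for t
  proof -
    have "(\<integral>\<^sup>+\<omega>. ennreal ((state x (warmup a) t \<omega> - target t \<omega>)\<^sup>2) \<partial>M) \<le>
      (\<integral>\<^sup>+\<omega>. ennreal (2 / a) * (\<integral>\<^sup>+r\<in>{0..a}. ennreal ((target t \<omega> - target (t - r) \<omega>)\<^sup>2) \<partial>lborel)
        + ennreal (2 * max 0 (1 - t / a)) * ennreal ((target 0 \<omega> - x)\<^sup>2) \<partial>M)"
    proof (rule nn_integral_mono_AE)
      show "AE \<omega> in M. ennreal ((state x (warmup a) t \<omega> - target t \<omega>)\<^sup>2) \<le>
        ennreal (2 / a) * (\<integral>\<^sup>+r\<in>{0..a}. ennreal ((target t \<omega> - target (t - r) \<omega>)\<^sup>2) \<partial>lborel)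
        + ennreal (2 * max 0 (1 - t / a)) * ennreal ((target 0 \<omega> - x)\<^sup>2)"
        using warmup_state[OF a] AE_space
      proof eventually_elim
        case (elim \<omega>)
        define b where "b = max 0 (1 - t / a)"
        have b: "0 \<le> b" "b \<le> 1" using t a by (auto simp: b_def)
        define I where "I = (LINT r:{0..a}|lborel. target (t - r) \<omega> - target t \<omega>) / a"
        have "(state x (warmup a) t \<omega> - target t \<omega>)\<^sup>2 = (I + b * (x - target 0 \<omega>))\<^sup>2"
          using elim(1) t by (simp add: I_def b_def)
        also have "\<dots> \<le> 2 * I\<^sup>2 + 2 * (b * (x - target 0 \<omega>))\<^sup>2" by (rule power2_sum_le)
        \<comment> \<open>From \<open>b^2 \<le> b\<close> on \<open>[0,1]\<close>; the ramp then
          enters linearly, as in \<open>ramp_integral\<close>.\<close>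
        also have "(b * (x - target 0 \<omega>))\<^sup>2 \<le> b * (target 0 \<omega> - x)\<^sup>2"
          using b mult_right_mono[of "b\<^sup>2" b "(target 0 \<omega> - x)\<^sup>2"]
          by (simp add: power_mult_distrib power2_commute[of x] power2_eq_square[of b] mult_left_le)
        finally have "(state x (warmup a) t \<omega> - target t \<omega>)\<^sup>2 \<le> 2 * I\<^sup>2 + 2 * b * (target 0 \<omega> - x)\<^sup>2" by simp
        then have "ennreal ((state x (warmup a) t \<omega> - target t \<omega>)\<^sup>2) \<le> ennreal (2 * I\<^sup>2 + 2 * b * (target 0 \<omega> - x)\<^sup>2)"
          by (rule ennreal_leI)
        also have "\<dots> = 2 * ennreal (I\<^sup>2) + ennreal (2 * b) * ennreal ((target 0 \<omega> - x)\<^sup>2)"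
          using b by (simp add: ennreal_mult)
        finally have "ennreal ((state x (warmup a) t \<omega> - target t \<omega>)\<^sup>2) \<le> 2 * ennreal (I\<^sup>2) + ennreal (2 * b) * ennreal ((target 0 \<omega> - x)\<^sup>2)" .
        moreover have "ennreal (I\<^sup>2) \<le> ennreal (1 / a) * (\<integral>\<^sup>+r\<in>{0..a}. ennreal ((target (t - r) \<omega> - target t \<omega>)\<^sup>2) \<partial>lborel)"
          unfolding I_def
          by (rule mean_square_le[OF _ a]) (use target_path_measurable[OF elim(2)] in measurable)
        then have "2 * ennreal (I\<^sup>2) \<le> ennreal (2 / a) * (\<integral>\<^sup>+r\<in>{0..a}. ennreal ((target t \<omega> - target (t - r) \<omega>)\<^sup>2) \<partial>lborel)"
        proof -
          have "ennreal (2 / a) = 2 * ennreal (1 / a)"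
            using a by (simp add: ennreal_mult'[symmetric] flip: ennreal_numeral)
          then show ?thesis
            using \<open>ennreal (I\<^sup>2) \<le> _\<close> mult_left_mono[of _ _ "2::ennreal"]
            by (simp add: mult.assoc power2_commute)
        qed
        ultimately show ?case unfolding b_def by (meson add_right_mono order_trans)
      qed
    qed
    also have "\<dots> = ennreal (2 / a) * (\<integral>\<^sup>+\<omega>. (\<integral>\<^sup>+r\<in>{0..a}. ennreal ((target t \<omega> - target (t - r) \<omega>)\<^sup>2) \<partial>lborel) \<partial>M)
        + ennreal (2 * max 0 (1 - t / a)) * initial_gap"
      unfolding initial_gap_eq
      by (subst nn_integral_add) (auto simp: nn_integral_cmult)
    also have "(\<integral>\<^sup>+\<omega>. (\<integral>\<^sup>+r\<in>{0..a}. ennreal ((target t \<omega> - target (t - r) \<omega>)\<^sup>2) \<partial>lborel) \<partial>M) = (\<integral>\<^sup>+r\<in>{0..a}. G t r \<partial>lborel)"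
      unfolding G_def by (rule nn_integral_time_swap) measurable
    finally show ?thesis .
  qed
  have "(\<integral>\<^sup>+t\<in>{0..T}. (\<integral>\<^sup>+\<omega>. ennreal ((state x (warmup a) t \<omega> - target t \<omega>)\<^sup>2) \<partial>M) \<partial>lborel)
    \<le> (\<integral>\<^sup>+t. ennreal (2 / a) * (\<integral>\<^sup>+r. G t r * indicator {0..a} r * indicator {0..T} t \<partial>lborel) +
        2 * initial_gap * (ennreal (max 0 (1 - t / a)) * indicator {0..T} t) \<partial>lborel)"
  proof (rule nn_integral_mono)
    fix t
    show "(\<integral>\<^sup>+\<omega>. ennreal ((state x (warmup a) t \<omega> - target t \<omega>)\<^sup>2) \<partial>M) * indicator {0..T} t \<le>
      ennreal (2 / a) * (\<integral>\<^sup>+r. G t r * indicator {0..a} r * indicator {0..T} t \<partial>lborel) +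
        2 * initial_gap * (ennreal (max 0 (1 - t / a)) * indicator {0..T} t)"
      using ptw[of t] by (cases "t \<in> {0..T}") (auto simp: ennreal_mult' ac_simps)
  qed
  also have "\<dots> = ennreal (2 / a) * (\<integral>\<^sup>+t. \<integral>\<^sup>+r. G t r * indicator {0..a} r * indicator {0..T} t \<partial>lborel \<partial>lborel) +
      2 * initial_gap * (\<integral>\<^sup>+t\<in>{0..T}. ennreal (max 0 (1 - t / a)) \<partial>lborel)"
    by (subst nn_integral_add) (auto simp: nn_integral_cmult)
  \<comment> \<open>The seminorm bounds the integral over \<open>t\<close> for a fixed shift, so
    \<open>t\<close> has to become the inner variable.\<close>
  also have "(\<integral>\<^sup>+t. \<integral>\<^sup>+r. G t r * indicator {0..a} r * indicator {0..T} t \<partial>lborel \<partial>lborel) =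
      (\<integral>\<^sup>+r. \<integral>\<^sup>+t. G t r * indicator {0..a} r * indicator {0..T} t \<partial>lborel \<partial>lborel)"
    by (rule lborel_pair.Fubini'[symmetric]) (unfold split_beta', measurable)
  also have "\<dots> \<le> (\<integral>\<^sup>+r. ennreal a * seminorm * indicator {0..a} r \<partial>lborel)"
  proof (rule nn_integral_mono)
    fix r
    show "(\<integral>\<^sup>+t. G t r * indicator {0..a} r * indicator {0..T} t \<partial>lborel) \<le> ennreal a * seminorm * indicator {0..a} r"
    proof (cases "r \<in> {0..a}")
      case True
      have "(\<integral>\<^sup>+t\<in>{0..T}. G t r \<partial>lborel) \<le> ennreal a * seminorm"
      \<comment> \<open>The supremum in the seminorm runs over positive shifts only; for
        \<open>r = 0\<close> the increment is 0.\<close>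
      proof (cases "r = 0")
        case False
        then have "r > 0" using True by auto
        then have "(\<integral>\<^sup>+t\<in>{0..T}. G t r \<partial>lborel) \<le> ennreal r * seminorm"
          using transl_modulus_le[of r] transl_modulus_eq[of r] by (simp add: G_def)
        also have "\<dots> \<le> ennreal a * seminorm"
          using True by (intro mult_right_mono ennreal_leI) auto
        finally show ?thesis .
      qed (simp add: G_def)
      then show ?thesis using True by simp
    qed simp
  qed
  also have "\<dots> = ennreal a * seminorm * ennreal a"
    using a by (simp add: nn_integral_cmult)
  finally have "(\<integral>\<^sup>+t\<in>{0..T}. (\<integral>\<^sup>+\<omega>. ennreal ((state x (warmup a) t \<omega> - target t \<omega>)\<^sup>2) \<partial>M) \<partial>lborel)
    \<le> ennreal (2 / a) * (ennreal a * seminorm * ennreal a) + 2 * initial_gap * (\<integral>\<^sup>+t\<in>{0..T}. ennreal (max 0 (1 - t / a)) \<partial>lborel)"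
    by (simp add: mult_left_mono add_right_mono)
  also have "\<dots> \<le> ennreal (2 / a) * (ennreal a * seminorm * ennreal a) + 2 * initial_gap * ennreal (a / 2)"
    by (intro add_left_mono mult_left_mono ramp_integral a) simp
  also have "\<dots> = ennreal a * (2 * seminorm + initial_gap)"
  proof -
    have 1: "ennreal (2 / a) * ennreal a = 2" and 2: "2 * ennreal (a / 2) = ennreal a"
      using a by (simp_all add: ennreal_mult'[symmetric] flip: ennreal_numeral)
    have "ennreal (2 / a) * (ennreal a * seminorm * ennreal a) + 2 * initial_gap * ennreal (a / 2)
      = (ennreal (2 / a) * ennreal a) * seminorm * ennreal a + initial_gap * (2 * ennreal (a / 2))"
      by (simp add: ac_simps)
    then show ?thesis unfolding 1 2 by (simp add: algebra_simps)
  qed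
  finally show ?thesis .
qed

end

section \<open>Dyadic steering to the terminal value\<close>

lemma ennreal_suminf_head: "(\<Sum>k. f k) = f 0 + (\<Sum>k. f (Suc k))" for f :: "nat \<Rightarrow> ennreal"
  using sums_unique[OF sums_Suc[OF summable_sums[OF summableI], of f]] by (simp add: add.commute)

text \<open>The control \<open>w\<close> before the switch is kept general; \<open>warmup a\<close>
  is inserted later. Finiteness of the gap makes the state at \<open>\<tau>\<close> square
  integrable; an infinite gap is treated separately, where the bound is trivial.\<close>

locale dyadic_steering = tracking_problem M T F \<xi> \<Xi> \<Xi>\<^sub>T x
  for M :: "'a measure" and T F \<xi> \<Xi> \<Xi>\<^sub>T x +
  fixes w :: "real \<Rightarrow> 'a \<Rightarrow> real" and \<tau> :: real
  assumes progressive_w: "progressive T F w"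
    and w_measurable [measurable]: "(\<lambda>(t, \<omega>). w t \<omega>) \<in> borel_measurable (borel \<Otimes>\<^sub>M M)"
    and w_energy: "time_energy M 0 T w < \<top>"
    and tau: "0 \<le> \<tau>" "\<tau> < T"
    and gap_finite: "(\<integral>\<^sup>+\<omega>. ennreal ((state x w \<tau> \<omega> - mart \<tau> \<omega>)\<^sup>2) \<partial>M) < \<top>"
begin

definition gap :: ennreal where
  "gap = (\<integral>\<^sup>+\<omega>. ennreal ((state x w \<tau> \<omega> - mart \<tau> \<omega>)\<^sup>2) \<partial>M)"

definition knot :: "nat \<Rightarrow> real" where
  "knot k = T - (T - \<tau>) / 2 ^ k"

definition len :: "nat \<Rightarrow> real" where
  "len k = (T - \<tau>) / 2 ^ Suc k"

text \<open>Left-open, so that the segments partition the open interval from \<open>\<tau>\<close>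
  to \<open>T\<close> and match the intervals measured by the Stieltjes measure.\<close>

definition seg :: "nat \<Rightarrow> real set" where
  "seg k = {knot k<..knot (Suc k)}"

text \<open>The state to be attained at \<open>knot k\<close>. The martingale value lags by one knot
  because the slope on \<open>seg k\<close> must be known when that segment starts.\<close>

definition waypoint :: "nat \<Rightarrow> 'a \<Rightarrow> real" where
  "waypoint k = (case k of 0 \<Rightarrow> state x w \<tau> | Suc j \<Rightarrow> mart (knot j))"

definition slope :: "nat \<Rightarrow> 'a \<Rightarrow> real" where
  "slope k \<omega> = (waypoint (Suc k) \<omega> - waypoint k \<omega>) / len k"

text \<open>At most one term of the series is nonzero at any time, and all terms vanish from
  \<open>T\<close> on; the series form delivers measurability at once.\<close>

definition steer :: "real \<Rightarrow> 'a \<Rightarrow> real" where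
  "steer t \<omega> = indicator {..\<tau>} t * w t \<omega> + (\<Sum>k. indicator (seg k) t * slope k \<omega>)"

text \<open>This is \<open>information_integral\<close> started at \<open>\<tau>\<close>.\<close>

definition info :: ennreal where
  "info = (\<integral>\<^sup>+r\<in>{\<tau><..T}. 1 / ennreal (T - r) \<partial>\<mu>)"

lemma knot_0 [simp]: "knot 0 = \<tau>" by (simp add: knot_def)

lemma len_pos [simp]: "0 < len k" using tau by (simp add: len_def)

lemma len_nonneg [simp]: "0 \<le> len k" using len_pos less_imp_le by blast

lemma knot_Suc: "knot (Suc k) = knot k + len k"
  by (simp add: knot_def len_def)

lemma knot_less_T [simp]: "knot k < T" using tau by (simp add: knot_def)

lemma knot_le_T [simp]: "knot k \<le> T" using knot_less_T less_imp_le by blast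

lemma knot_mono: "i \<le> j \<Longrightarrow> knot i \<le> knot j"
  by (rule lift_Suc_mono_le[of knot]) (simp_all add: knot_Suc)

lemma knot_ge_tau [simp]: "\<tau> \<le> knot k" using knot_mono[of 0 k] by simp

lemma knot_nonneg [simp]: "0 \<le> knot k" using knot_ge_tau[of k] tau by linarith

lemma knot_lim: "knot \<longlonglongrightarrow> T"
proof -
  have "(\<lambda>k. T - (T - \<tau>) * (1 / 2) ^ k) \<longlonglongrightarrow> T - (T - \<tau>) * 0"
    by (intro tendsto_intros LIMSEQ_realpow_zero) auto
  then show ?thesis by (simp add: knot_def[abs_def] power_divide)
qed

lemma seg_disjoint: "disjoint_family seg"
  unfolding disjoint_family_on_def
proof safe
  have *: False if "t \<in> seg i" "t \<in> seg j" "i < j" for i j t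
    using that knot_mono[of "Suc i" j] by (auto simp: seg_def)
  fix i j t assume "i \<noteq> j" "t \<in> seg i" "t \<in> seg j"
  then show "t \<in> {}" using *[of t i j] *[of t j i] by (cases "i < j") auto
qed

lemma seg_subset: "seg k \<subseteq> {\<tau><..<T}"
  using knot_ge_tau[of k] knot_less_T[of "Suc k"] by (auto simp: seg_def simp del: knot_ge_tau knot_less_T)

text \<open>The least knot not before \<open>t\<close> cannot be \<open>knot 0 = \<tau>\<close>; its
  predecessor is the index of the segment.\<close>

lemma seg_cover: "t \<in> {\<tau><..<T} \<Longrightarrow> \<exists>k. t \<in> seg k"
proof -
  assume t: "t \<in> {\<tau><..<T}"
  then have "\<forall>\<^sub>F k in sequentially. t < knot k"
    using order_tendstoD(1)[OF knot_lim] by auto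
  then have ex: "\<exists>k. t \<le> knot k"
    using eventually_happens[of _ sequentially] by (auto intro: less_imp_le)
  define k where "k = (LEAST k. t \<le> knot k)"
  have k: "t \<le> knot k" unfolding k_def using ex by (rule LeastI_ex)
  with t have "k \<noteq> 0" by (auto intro: ccontr)
  then obtain j where j: "k = Suc j" by (cases k) auto
  have "\<not> t \<le> knot j"
    using not_less_Least[of j "\<lambda>k. t \<le> knot k"] j by (simp add: k_def)
  then show ?thesis using k j by (auto simp: seg_def intro!: exI[of _ j])
qed

lemma seg_measurable [measurable, simp]: "seg k \<in> sets borel" by (simp add: seg_def)

lemma emeasure_seg: "emeasure lborel (seg k) = ennreal (len k)"
  by (simp add: seg_def knot_Suc)

lemma steer_before: "t \<le> \<tau> \<Longrightarrow> steer t \<omega> = w t \<omega>"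
proof -
  assume t: "t \<le> \<tau>"
  have "t \<notin> seg k" for k using seg_subset[of k] t by auto
  then show ?thesis using t by (simp add: steer_def)
qed

lemma steer_seg: "t \<in> seg k \<Longrightarrow> steer t \<omega> = slope k \<omega>"
proof -
  assume t: "t \<in> seg k"
  have "(\<Sum>j. indicator (seg j) t * slope j \<omega>) = (\<Sum>j\<in>{k}. indicator (seg j) t * slope j \<omega>)"
  proof (rule suminf_finite)
    fix j assume "j \<notin> {k}"
    then have "t \<notin> seg j" using disjoint_family_onD[OF seg_disjoint, of j k] t by auto
    then show "indicator (seg j) t * slope j \<omega> = 0" by simp
  qed simp
  then show ?thesis using t seg_subset[of k] by (auto simp: steer_def)
qed

lemma steer_after: "t \<ge> T \<Longrightarrow> steer t \<omega> = 0"
proof -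
  assume t: "t \<ge> T"
  have "t \<notin> seg k" for k using seg_subset[of k] t by auto
  then show ?thesis using t tau by (simp add: steer_def)
qed

lemma waypoint_measurable_F: "waypoint k \<in> borel_measurable (F (knot k))"
proof (cases k)
  case 0
  then show ?thesis
    using progressive_state_measurable[OF progressive_w] tau by (simp add: waypoint_def)
next
  case (Suc j)
  have "mart (knot j) \<in> borel_measurable (F (knot j))"
    by (rule mart_measurable_F) simp
  then have "mart (knot j) \<in> borel_measurable (F (knot k))"
    by (rule measurable_from_subalg[OF subalgebra_F_mono, rotated -1])
       (use Suc knot_mono[of j k] in auto)
  then show ?thesis using Suc by (simp add: waypoint_def)
qed

lemma waypoint_measurable [measurable]: "waypoint k \<in> borel_measurable M"
  by (rule F_measurable_imp_measurable[OF waypoint_measurable_F]) auto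

lemma slope_measurable [measurable]: "slope k \<in> borel_measurable M"
  unfolding slope_def[abs_def] by measurable

text \<open>The purpose of the lag: the destination \<open>waypoint (Suc k)\<close> is
  \<open>mart (knot k)\<close>, observed at the start of the segment.\<close>

lemma slope_measurable_F: "slope k \<in> borel_measurable (F (knot k))"
proof -
  have "mart (knot k) \<in> borel_measurable (F (knot k))"
    by (rule mart_measurable_F) simp
  then have "waypoint (Suc k) \<in> borel_measurable (F (knot k))" by (simp add: waypoint_def)
  then show ?thesis
    unfolding slope_def[abs_def] using waypoint_measurable_F[of k] by measurable
qed

lemma progressive_steer: "progressive T F steer"
proof -
  have "progressive T F (\<lambda>t \<omega>. indicator (seg k) t * slope k \<omega>)" for k
    by (rule progressive_after[where s = "knot k" and F = F])
       (auto intro!: slope_measurable_F subalgebra_F_mono order_trans[OF knot_nonneg] simp: seg_def)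
  from progressive_suminf[OF this] show ?thesis
    unfolding steer_def[abs_def]
    by (intro progressive_add progressive_time_mult progressive_w) auto
qed

lemma steer_measurable [measurable]: "(\<lambda>(t, \<omega>). steer t \<omega>) \<in> borel_measurable (borel \<Otimes>\<^sub>M M)"
  unfolding steer_def split_beta' by measurable

lemma waypoint_L2: "integrable M (\<lambda>\<omega>. (waypoint k \<omega>)\<^sup>2)"
proof (cases k)
  case 0
  have [measurable]: "state x w \<tau> \<in> borel_measurable M"
    using waypoint_measurable[of 0] by (simp add: waypoint_def)
  have "integrable M (\<lambda>\<omega>. (state x w \<tau> \<omega> - mart \<tau> \<omega>)\<^sup>2)"
    using gap_finite by (intro integrableI_nonneg) auto
  \<comment> \<open>The state is the difference of the gap variable and
    \<open>- mart \<tau>\<close>, both square integrable.\<close>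
  from integrable_diff_squared(1)[OF _ _ this, of "\<lambda>\<omega>. - mart \<tau> \<omega>"]
  show ?thesis using 0 by (simp add: waypoint_def)
qed (simp add: waypoint_def)

section \<open>Energy of the steering phase\<close>

definition jump_energy :: "nat \<Rightarrow> ennreal" where
  "jump_energy k = (\<integral>\<^sup>+\<omega>. ennreal ((waypoint (Suc k) \<omega> - waypoint k \<omega>)\<^sup>2) \<partial>M)"

lemma jump_energy_0: "jump_energy 0 = gap"
  by (simp add: jump_energy_def gap_def waypoint_def power2_commute)

text \<open>By the lag, the displacement on \<open>seg (Suc k)\<close> is the martingale increment
  over the preceding \<open>seg k\<close>, where the time to \<open>T\<close> is at most
  \<open>T - knot k\<close>.\<close>

lemma jump_energy_Suc:
  "jump_energy (Suc k) \<le> ennreal (T - knot k) * (\<integral>\<^sup>+r\<in>seg k. 1 / ennreal (T - r) \<partial>\<mu>)"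
proof -
  have "jump_energy (Suc k) = ennreal (second_moment (knot (Suc k)) - second_moment (knot k))"
    using mart_increment_nn[OF knot_mono[of k "Suc k"]]
    by (simp add: jump_energy_def waypoint_def power2_commute)
  also have "\<dots> \<le> ennreal (T - knot k) * (\<integral>\<^sup>+r\<in>seg k. 1 / ennreal (T - r) \<partial>\<mu>)"
    unfolding seg_def
    using knot_mono[of k "Suc k"] knot_less_T[of k] knot_less_T[of "Suc k"]
    by (intro second_moment_increment_le[OF order_refl]) (auto simp del: knot_less_T)
  finally show ?thesis .
qed

text \<open>Crossing a segment at constant speed costs squared displacement over length. The first
  segment pays for the gap at length \<open>(T - \<tau>) / 2\<close>; every later one pays for
  information from the segment before it, and these pieces are disjoint parts of
  \<open>info\<close>.\<close>

lemma jump_energy_sum: "(\<Sum>k. jump_energy k * ennreal (1 / len k)) \<le> gap * ennreal (2 / (T - \<tau>)) + 4 * info"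
proof -
  have "jump_energy (Suc k) * ennreal (1 / len (Suc k)) \<le> 4 * (\<integral>\<^sup>+r\<in>seg k. 1 / ennreal (T - r) \<partial>\<mu>)" for k
  proof -
    \<comment> \<open>Here \<open>(T - \<tau>) / 2^k\<close> is divided by
      \<open>(T - \<tau>) / 2^(k+2)\<close>: one halving because a segment is half the remaining
      time, one because of the lag.\<close>
    have "(T - knot k) * (1 / len (Suc k)) = 4"
      using tau by (simp add: knot_def len_def field_simps)
    then have *: "ennreal (T - knot k) * ennreal (1 / len (Suc k)) = 4"
      using knot_less_T[of k] len_pos[of "Suc k"]
      by (simp add: ennreal_mult[symmetric] less_imp_le del: knot_less_T len_pos)
    have "jump_energy (Suc k) * ennreal (1 / len (Suc k)) \<le>
        (ennreal (T - knot k) * (\<integral>\<^sup>+r\<in>seg k. 1 / ennreal (T - r) \<partial>\<mu>)) * ennreal (1 / len (Suc k))"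
      by (rule mult_right_mono[OF jump_energy_Suc]) simp
    also have "\<dots> = (ennreal (T - knot k) * ennreal (1 / len (Suc k))) * (\<integral>\<^sup>+r\<in>seg k. 1 / ennreal (T - r) \<partial>\<mu>)"
      by (simp only: ac_simps)
    finally show ?thesis unfolding * .
  qed
  then have "(\<Sum>k. jump_energy (Suc k) * ennreal (1 / len (Suc k))) \<le>
      (\<Sum>k. 4 * (\<integral>\<^sup>+r\<in>seg k. 1 / ennreal (T - r) \<partial>\<mu>))"
    by (intro suminf_le summableI)
  also have "\<dots> = 4 * (\<integral>\<^sup>+r. (\<Sum>k. 1 / ennreal (T - r) * indicator (seg k) r) \<partial>\<mu>)"
    by (subst nn_integral_suminf) auto
  also have "\<dots> \<le> 4 * info"
  proof -
    have "(\<Sum>k. 1 / ennreal (T - r) * indicator (seg k) r) \<le> 1 / ennreal (T - r) * indicator {\<tau><..T} r" for r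
      unfolding ennreal_suminf_cmult suminf_indicator[OF seg_disjoint]
      by (intro mult_left_mono indicator_leI) (use seg_subset in fastforce)+
    then show ?thesis
      unfolding info_def by (intro mult_left_mono nn_integral_mono) auto
  qed
  finally have "(\<Sum>k. jump_energy (Suc k) * ennreal (1 / len (Suc k))) \<le> 4 * info" .
  moreover have "jump_energy 0 * ennreal (1 / len 0) = gap * ennreal (2 / (T - \<tau>))"
    by (simp add: jump_energy_0 len_def)
  ultimately show ?thesis
    by (subst ennreal_suminf_head) (simp add: add_left_mono)
qed

lemma slope_energy:
  "(\<integral>\<^sup>+\<omega>. ennreal ((slope k \<omega>)\<^sup>2) \<partial>M) * ennreal (len k) = jump_energy k * ennreal (1 / len k)"
proof -
  have "(\<integral>\<^sup>+\<omega>. ennreal ((slope k \<omega>)\<^sup>2) \<partial>M) = (\<integral>\<^sup>+\<omega>. ennreal ((waypoint (Suc k) \<omega> - waypoint k \<omega>)\<^sup>2) * ennreal (1 / (len k)\<^sup>2) \<partial>M)"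
    by (intro nn_integral_cong) (simp add: slope_def power_divide ennreal_mult'[symmetric])
  also have "\<dots> = jump_energy k * ennreal (1 / (len k)\<^sup>2)"
    unfolding jump_energy_def by (rule nn_integral_multc) measurable
  finally show ?thesis
    using len_pos[of k] by (simp add: mult.assoc ennreal_mult'[symmetric] power2_eq_square del: len_pos)
qed

text \<open>The energy of \<open>w\<close> is kept on all of \<open>[0,T]\<close>, which only
  enlarges the bound and makes it independent of \<open>\<tau>\<close> in that term.\<close>

lemma steer_energy: "time_energy M 0 T steer \<le> time_energy M 0 T w + gap * ennreal (2 / (T - \<tau>)) + 4 * info"
proof -
  have ptw: "ennreal ((steer t \<omega>)\<^sup>2) * indicator {0..T} t \<le>
    ennreal ((w t \<omega>)\<^sup>2) * indicator {0..T} t + (\<Sum>k. ennreal ((slope k \<omega>)\<^sup>2) * indicator (seg k) t)" for t \<omega>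
  proof -
    consider "t \<le> \<tau>" | "t \<in> {\<tau><..<T}" | "t \<ge> T" by force
    then show ?thesis
    proof cases
      case 2
      then obtain k where k: "t \<in> seg k" using seg_cover by blast
      have "t \<in> {0..T}" using 2 tau by auto
      then show ?thesis
        using suminf_cmult_indicator[OF seg_disjoint k, of "\<lambda>k. ennreal ((slope k \<omega>)\<^sup>2)"] steer_seg[OF k]
        by simp
    qed (auto simp: steer_before steer_after)
  qed
  have "time_energy M 0 T steer \<le> (\<integral>\<^sup>+\<omega>. (\<integral>\<^sup>+t. ennreal ((w t \<omega>)\<^sup>2) * indicator {0..T} t +
      (\<Sum>k. ennreal ((slope k \<omega>)\<^sup>2) * indicator (seg k) t) \<partial>lborel) \<partial>M)"
    unfolding time_energy_def by (intro nn_integral_mono ptw)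
  also have "\<dots> = (\<integral>\<^sup>+\<omega>. (\<integral>\<^sup>+t\<in>{0..T}. ennreal ((w t \<omega>)\<^sup>2) \<partial>lborel) +
      (\<Sum>k. ennreal ((slope k \<omega>)\<^sup>2) * ennreal (len k)) \<partial>M)"
  proof (rule nn_integral_cong)
    fix \<omega> assume "\<omega> \<in> space M"
    then have [measurable]: "(\<lambda>t. w t \<omega>) \<in> borel_measurable borel"
      using measurable_compose[OF measurable_Pair[OF measurable_ident measurable_const] w_measurable]
      by (simp add: id_def)
    show "(\<integral>\<^sup>+t. ennreal ((w t \<omega>)\<^sup>2) * indicator {0..T} t +
      (\<Sum>k. ennreal ((slope k \<omega>)\<^sup>2) * indicator (seg k) t) \<partial>lborel) =
      (\<integral>\<^sup>+t\<in>{0..T}. ennreal ((w t \<omega>)\<^sup>2) \<partial>lborel) + (\<Sum>k. ennreal ((slope k \<omega>)\<^sup>2) * ennreal (len k))"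
      by (simp add: nn_integral_add nn_integral_suminf nn_integral_cmult emeasure_seg)
  qed
  also have "\<dots> = time_energy M 0 T w + (\<Sum>k. (\<integral>\<^sup>+\<omega>. ennreal ((slope k \<omega>)\<^sup>2) \<partial>M) * ennreal (len k))"
    unfolding time_energy_def
    by (subst nn_integral_add) (auto simp: nn_integral_suminf nn_integral_multc)
  also have "\<dots> \<le> time_energy M 0 T w + (gap * ennreal (2 / (T - \<tau>)) + 4 * info)"
    unfolding slope_energy by (intro add_left_mono jump_energy_sum)
  finally show ?thesis by (simp add: add.assoc)
qed

lemma info_finite: "info < \<top>"
proof -
  have "info \<le> information_integral M T \<Xi> 0"
    unfolding info_def information_integral_def using tau
    by (intro nn_integral_mono) (auto simp: indicator_def)
  then show ?thesis using information_finite by (rule le_less_trans)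
qed

lemma steer_energy_finite: "time_energy M 0 T steer < \<top>"
proof -
  have "time_energy M 0 T w + gap * ennreal (2 / (T - \<tau>)) + 4 * info < \<top>"
    using w_energy gap_finite info_finite
    by (simp add: gap_def ennreal_mult_less_top)
  with steer_energy show ?thesis by (rule le_less_trans)
qed

lemma steer_control: "steer \<in> controls M T F"
  using progressive_steer steer_energy_finite by (simp add: controls_def)

lemma steer_state_before: "t \<le> \<tau> \<Longrightarrow> state x steer t \<omega> = state x w t \<omega>"
  unfolding state_def by (intro arg_cong2[where f = "(+)"] refl set_lebesgue_integral_cong) (auto simp: steer_before)

lemma steer_integrable_AE: "AE \<omega> in M. set_integrable lborel {0..T} (\<lambda>t. steer t \<omega>)"
  by (rule time_energy_finite_AE[OF steer_energy_finite steer_measurable])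

text \<open>Induction over the segments: on each one the control is constant, and its slope is
  chosen to land on the next waypoint. Integrability of the path allows splitting the integral at
  the knots.\<close>

lemma steer_state:
  assumes "set_integrable lborel {0..T} (\<lambda>t. steer t \<omega>)"
  shows "t \<in> {knot k..knot (Suc k)} \<Longrightarrow> state x steer t \<omega> = waypoint k \<omega> + (t - knot k) * slope k \<omega>"
proof (induction k arbitrary: t)
  have step: "state x steer t \<omega> = state x steer (knot k) \<omega> + (t - knot k) * slope k \<omega>"
    if t: "t \<in> {knot k..knot (Suc k)}" for t k
  proof -
    have "t \<le> T" using t knot_less_T[of "Suc k"] by (auto simp del: knot_less_T)
    then have i: "set_integrable lborel {0..t} (\<lambda>t. steer t \<omega>)"
      by (intro set_integrable_subset[OF assms]) auto
    have "(LINT s:{knot k<..t}|lborel. steer s \<omega>) = (LINT s:{knot k<..t}|lborel. slope k \<omega>)"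
      by (rule set_lebesgue_integral_cong) (use t in \<open>auto simp: seg_def intro!: steer_seg\<close>)
    also have "\<dots> = (t - knot k) * slope k \<omega>"
      using t unfolding set_lebesgue_integral_def by simp
    finally show ?thesis
      using set_integral_Icc_split(1)[OF i, of "knot k"] t by (simp add: state_def)
  qed
  {
    case 0
    then show ?case using step[OF 0] steer_state_before[of \<tau>] by (simp add: waypoint_def)
  next
    case (Suc k)
    have "state x steer (knot (Suc k)) \<omega> = waypoint k \<omega> + len k * slope k \<omega>"
      using Suc.IH[of "knot (Suc k)"] len_pos[of k] by (simp add: knot_Suc del: len_pos)
    also have "\<dots> = waypoint (Suc k) \<omega>"
      using len_pos[of k] by (simp add: slope_def del: len_pos)
    finally show ?case using step[OF Suc.prems] by simp
  }
qed

text \<open>By continuity the state at \<open>T\<close> is the limit of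
  \<open>mart (knot k)\<close>, hence a left limit that a jump at \<open>T\<close> could separate
  from \<open>mart T\<close>. Fatou bounds the mean square of the difference by the limit of
  \<open>(T - knot k) * info\<close>, which is 0 because \<open>info\<close> is finite.\<close>

lemma steer_terminal: "AE \<omega> in M. state x steer T \<omega> = \<Xi>\<^sub>T \<omega>"
proof -
  have st [measurable]: "state x steer T \<in> borel_measurable M"
    using F_measurable_imp_measurable[OF progressive_state_measurable[OF progressive_steer]] tau by auto
  have lim: "AE \<omega> in M. (\<lambda>k. mart (knot k) \<omega>) \<longlonglongrightarrow> state x steer T \<omega>"
    using steer_integrable_AE
  proof eventually_elim
    case (elim \<omega>)
    have "mart (knot k) \<omega> = state x steer (knot (Suc k)) \<omega>" for k
      using steer_state[OF elim, of "knot (Suc k)" "Suc k"] knot_mono[of "Suc k" "Suc (Suc k)"]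
      by (simp add: waypoint_def)
    moreover have "(\<lambda>k. state x steer (knot (Suc k)) \<omega>) \<longlonglongrightarrow> state x steer T \<omega>"
    proof -
      have U: "(\<Union>k. {0..knot (Suc k)}) = {0..<T}"
      proof (intro equalityI subsetI)
        fix t assume "t \<in> {0..<T}"
        moreover from this have "\<forall>\<^sub>F k in sequentially. t < knot (Suc k)"
          using order_tendstoD(1)[OF LIMSEQ_Suc[OF knot_lim]] by auto
        then obtain k where "t < knot (Suc k)"
          using eventually_happens[of _ sequentially] by auto
        ultimately show "t \<in> (\<Union>k. {0..knot (Suc k)})" by (auto intro: less_imp_le)
      qed (auto intro: le_less_trans[OF _ knot_less_T])
      have "(\<lambda>k. LINT s:{0..knot (Suc k)}|lborel. steer s \<omega>) \<longlonglongrightarrow> (LINT s:(\<Union>k. {0..knot (Suc k)})|lborel. steer s \<omega>)"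
      proof (rule set_integral_cont_up)
        show "incseq (\<lambda>k. {0..knot (Suc k)})"
          by (auto simp: incseq_def intro: order_trans[OF _ knot_mono])
        show "set_integrable lborel (\<Union>k. {0..knot (Suc k)}) (\<lambda>t. steer t \<omega>)"
          unfolding U by (rule set_integrable_subset[OF elim]) auto
      qed simp
      \<comment> \<open>The knots never reach \<open>T\<close>, so their intervals exhaust only
        \<open>{0..<T}\<close>; at \<open>T\<close> itself \<open>steer\<close> is 0.\<close>
      moreover have "(LINT s:{0..<T}|lborel. steer s \<omega>) = (LINT s:{0..T}|lborel. steer s \<omega>)"
        unfolding set_lebesgue_integral_def
        by (intro Bochner_Integration.integral_cong) (auto simp: indicator_def steer_after)
      ultimately show ?thesis
        unfolding state_def U by (intro tendsto_intros) simp
    qed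
    ultimately show ?case by simp
  qed
  have "(\<integral>\<^sup>+\<omega>. ennreal ((state x steer T \<omega> - mart T \<omega>)\<^sup>2) \<partial>M)
      = (\<integral>\<^sup>+\<omega>. liminf (\<lambda>k. ennreal ((mart (knot k) \<omega> - mart T \<omega>)\<^sup>2)) \<partial>M)"
  proof (rule nn_integral_cong_AE)
    show "AE \<omega> in M. ennreal ((state x steer T \<omega> - mart T \<omega>)\<^sup>2) = liminf (\<lambda>k. ennreal ((mart (knot k) \<omega> - mart T \<omega>)\<^sup>2))"
      using lim
    proof eventually_elim
      case (elim \<omega>)
      then have "(\<lambda>k. ennreal ((mart (knot k) \<omega> - mart T \<omega>)\<^sup>2)) \<longlonglongrightarrow> ennreal ((state x steer T \<omega> - mart T \<omega>)\<^sup>2)"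
        by (intro tendsto_intros)
      then show ?case by (rule lim_imp_Liminf[OF sequentially_bot, symmetric])
    qed
  qed
  also have "\<dots> \<le> liminf (\<lambda>k. \<integral>\<^sup>+\<omega>. ennreal ((mart (knot k) \<omega> - mart T \<omega>)\<^sup>2) \<partial>M)"
    by (rule nn_integral_liminf) measurable
  also have "\<dots> \<le> liminf (\<lambda>k. ennreal (T - knot k) * info)"
  proof (rule Liminf_mono, rule always_eventually, rule allI)
    fix k
    have "(\<integral>\<^sup>+\<omega>. ennreal ((mart (knot k) \<omega> - mart T \<omega>)\<^sup>2) \<partial>M) = ennreal (second_moment T - second_moment (knot k))"
      by (rule mart_increment_nn) (simp add: less_imp_le)
    also have "\<dots> \<le> ennreal (T - knot k) * (\<integral>\<^sup>+r\<in>{knot k<..T}. 1 / ennreal (T - r) \<partial>\<mu>)"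
      by (rule second_moment_increment_le[OF order_refl]) (auto simp: less_imp_le)
    also have "\<dots> \<le> ennreal (T - knot k) * info"
      unfolding info_def
      by (intro mult_left_mono nn_integral_mono indicator_leI)
         (use knot_ge_tau[of k] in \<open>auto intro: le_less_trans simp del: knot_ge_tau\<close>)
    finally show "(\<integral>\<^sup>+\<omega>. ennreal ((mart (knot k) \<omega> - mart T \<omega>)\<^sup>2) \<partial>M) \<le> ennreal (T - knot k) * info" .
  qed
  also have "liminf (\<lambda>k. ennreal (T - knot k) * info) = 0"
  proof (rule lim_imp_Liminf[OF sequentially_bot])
    obtain c where c: "info = ennreal c" "c \<ge> 0"
      using info_finite by (cases info) auto
    have "(\<lambda>k. ennreal ((T - knot k) * c)) \<longlonglongrightarrow> ennreal ((T - T) * c)"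
      by (intro tendsto_intros knot_lim)
    then show "(\<lambda>k. ennreal (T - knot k) * info) \<longlonglongrightarrow> 0"
      using c by (simp add: ennreal_mult less_imp_le)
  qed
  finally have "(\<integral>\<^sup>+\<omega>. ennreal ((state x steer T \<omega> - mart T \<omega>)\<^sup>2) \<partial>M) = 0" by simp
  then have "AE \<omega> in M. ennreal ((state x steer T \<omega> - mart T \<omega>)\<^sup>2) = 0"
    by (subst (asm) nn_integral_0_iff_AE) auto
  then show ?thesis using mart_terminal by eventually_elim auto
qed

lemma steer_constrained: "steer \<in> constrained_controls M T F x \<Xi>\<^sub>T"
  using steer_control steer_terminal by (simp add: constrained_controls_def)

end

section \<open>Tracking error and cost of the steering phase\<close>

lemma convex_square_dist:
  fixes p q N \<theta> :: real
  assumes "0 \<le> \<theta>" "\<theta> \<le> 1"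
  shows "((1 - \<theta>) * p + \<theta> * q - N)\<^sup>2 \<le> (1 - \<theta>) * (p - N)\<^sup>2 + \<theta> * (q - N)\<^sup>2"
proof -
  have "(1 - \<theta>) * (p - N)\<^sup>2 + \<theta> * (q - N)\<^sup>2 - ((1 - \<theta>) * p + \<theta> * q - N)\<^sup>2 = \<theta> * (1 - \<theta>) * (p - q)\<^sup>2"
    by (simp add: power2_eq_square algebra_simps)
  moreover have "0 \<le> \<theta> * (1 - \<theta>) * (p - q)\<^sup>2" using assms by simp
  ultimately show ?thesis by linarith
qed

context tracking_problem
begin

lemma cost_eq:
  assumes [measurable]: "(\<lambda>(t, \<omega>). u t \<omega>) \<in> borel_measurable (borel \<Otimes>\<^sub>M M)"
  shows "cost M T x \<xi> \<kappa> u =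
    ennreal (1/2) * (\<integral>\<^sup>+t\<in>{0..T}. (\<integral>\<^sup>+\<omega>. ennreal ((state x u t \<omega> - target t \<omega>)\<^sup>2) \<partial>M) \<partial>lborel)
    + ennreal (\<kappa>/2) * time_energy M 0 T u"
proof -
  note state_jointly_measurable[OF assms, measurable]
  have *: "(\<integral>\<^sup>+t\<in>{0..T}. ennreal ((state x u t \<omega> - \<xi> t \<omega>)\<^sup>2) \<partial>lborel)
      = (\<integral>\<^sup>+t\<in>{0..T}. ennreal ((state x u t \<omega> - target t \<omega>)\<^sup>2) \<partial>lborel)" for \<omega>
    by (intro nn_integral_cong) (auto simp: indicator_def target_def clamp_id)
  have "cost M T x \<xi> \<kappa> u =
    ennreal (1/2) * (\<integral>\<^sup>+\<omega>. (\<integral>\<^sup>+t\<in>{0..T}. ennreal ((state x u t \<omega> - target t \<omega>)\<^sup>2) \<partial>lborel) \<partial>M)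
    + ennreal (\<kappa>/2) * time_energy M 0 T u"
    unfolding cost_def time_energy_def *
    by (subst nn_integral_add) (auto simp: nn_integral_cmult simp del: ennreal_half)
  then show ?thesis
    by (subst (asm) nn_integral_time_swap) auto
qed

end

context dyadic_steering
begin

lemma state_w_measurable [measurable]: "(\<lambda>(t, \<omega>). state x w t \<omega>) \<in> borel_measurable (borel \<Otimes>\<^sub>M M)"
  by (rule state_jointly_measurable[OF w_measurable])

lemma state_steer_measurable [measurable]: "(\<lambda>(t, \<omega>). state x steer t \<omega>) \<in> borel_measurable (borel \<Otimes>\<^sub>M M)"
  by (rule state_jointly_measurable[OF steer_measurable])

text \<open>By \<open>mart_increment_nn\<close> this is the mean square of
  \<open>mart T - mart \<tau>\<close>, the variation still to come at the switch.\<close>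

definition info_gain :: ennreal where
  "info_gain = ennreal (second_moment T - second_moment \<tau>)"

lemma info_gain_le: "info_gain \<le> ennreal (T - \<tau>) * info"
  unfolding info_gain_def info_def
  by (rule second_moment_increment_le[OF order_refl]) (use tau in auto)

lemma mart_knot_dist:
  assumes "knot k \<le> t" "t \<le> T"
  shows "(\<integral>\<^sup>+\<omega>. ennreal ((mart (knot k) \<omega> - mart t \<omega>)\<^sup>2) \<partial>M) \<le> info_gain"
  unfolding mart_increment_nn[OF assms(1)] info_gain_def
  using second_moment_mono[OF assms(2)] second_moment_mono[OF knot_ge_tau[of k]] by (intro ennreal_leI) linarith

text \<open>The initial waypoint is known at \<open>\<tau>\<close>, so Pythagoras adds the gap to a
  martingale increment. All others are earlier martingale values, at distance at most
  \<open>info_gain\<close> from \<open>mart t\<close>.\<close>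

lemma waypoint_dist:
  assumes "knot k \<le> t" "t \<le> T"
  shows "(\<integral>\<^sup>+\<omega>. ennreal ((waypoint k \<omega> - mart t \<omega>)\<^sup>2) \<partial>M) \<le> (if k = 0 then gap else 0) + info_gain"
proof (cases k)
  case 0
  have t: "\<tau> \<le> t" using assms(1) 0 by simp
  have i: "integrable M (\<lambda>\<omega>. (waypoint 0 \<omega> - mart s \<omega>)\<^sup>2)" for s
    by (rule integrable_diff_squared) (auto intro: waypoint_L2)
  have "(\<integral>\<^sup>+\<omega>. ennreal ((waypoint 0 \<omega> - mart t \<omega>)\<^sup>2) \<partial>M) = ennreal (LINT \<omega>|M. (waypoint 0 \<omega> - mart t \<omega>)\<^sup>2)"
    by (rule nn_integral_eq_integral[OF i]) simp
  also have "\<dots> = ennreal ((LINT \<omega>|M. (waypoint 0 \<omega> - mart \<tau> \<omega>)\<^sup>2) + (second_moment t - second_moment \<tau>))"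
    using mean_square_dist[OF tau(1) t assms(2) _ waypoint_L2[of 0]] waypoint_measurable_F[of 0] by simp
  also have "\<dots> = ennreal (LINT \<omega>|M. (waypoint 0 \<omega> - mart \<tau> \<omega>)\<^sup>2) + ennreal (second_moment t - second_moment \<tau>)"
    using second_moment_mono[OF t] by (intro ennreal_plus integral_nonneg_AE) auto
  also have "ennreal (LINT \<omega>|M. (waypoint 0 \<omega> - mart \<tau> \<omega>)\<^sup>2) = gap"
    unfolding gap_def by (subst nn_integral_eq_integral[OF i, symmetric]) (auto simp: waypoint_def)
  also have "ennreal (second_moment t - second_moment \<tau>) \<le> info_gain"
    unfolding info_gain_def using second_moment_mono[OF assms(2)] by (intro ennreal_leI) simp
  finally show ?thesis using 0 by (simp add: add_left_mono)
next
  case (Suc j)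
  have "knot j \<le> t" using assms(1) knot_mono[of j k] Suc by simp
  from mart_knot_dist[OF this assms(2)] show ?thesis
    using Suc by (simp add: waypoint_def)
qed

text \<open>Both the state and the target are compared with \<open>mart t\<close>; the cost factor
  \<open>1/2\<close> absorbs the 2 from squaring a sum. The state is a convex combination of two
  consecutive waypoints, and only the first segment involves the one that is not a martingale value,
  so only there the gap appears.\<close>

lemma steer_tracking_after:
  assumes t: "t \<in> {\<tau><..<T}"
  shows "ennreal (1/2) * (\<integral>\<^sup>+\<omega>. ennreal ((state x steer t \<omega> - target t \<omega>)\<^sup>2) \<partial>M) \<le>
    (\<integral>\<^sup>+\<omega>. ennreal ((target t \<omega> - mart t \<omega>)\<^sup>2) \<partial>M) + indicator {\<tau><..knot 1} t * gap + info_gain"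
proof -
  obtain k where k: "t \<in> seg k" using seg_cover[OF t] by blast
  define \<theta> where "\<theta> = (t - knot k) / len k"
  have \<theta>: "0 \<le> \<theta>" "\<theta> \<le> 1" using k len_pos[of k] by (auto simp: \<theta>_def seg_def knot_Suc field_simps)
  have kt: "knot k \<le> t" "t \<le> T" using k t by (auto simp: seg_def)
  have "(\<integral>\<^sup>+\<omega>. ennreal (1/2) * ennreal ((state x steer t \<omega> - target t \<omega>)\<^sup>2) \<partial>M) \<le>
    (\<integral>\<^sup>+\<omega>. ennreal ((target t \<omega> - mart t \<omega>)\<^sup>2) +
      (ennreal (1 - \<theta>) * ennreal ((waypoint k \<omega> - mart t \<omega>)\<^sup>2) +
       ennreal \<theta> * ennreal ((waypoint (Suc k) \<omega> - mart t \<omega>)\<^sup>2)) \<partial>M)"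
  proof (rule nn_integral_mono_AE)
    show "AE \<omega> in M. ennreal (1/2) * ennreal ((state x steer t \<omega> - target t \<omega>)\<^sup>2) \<le>
      ennreal ((target t \<omega> - mart t \<omega>)\<^sup>2) +
      (ennreal (1 - \<theta>) * ennreal ((waypoint k \<omega> - mart t \<omega>)\<^sup>2) +
       ennreal \<theta> * ennreal ((waypoint (Suc k) \<omega> - mart t \<omega>)\<^sup>2))"
      using steer_integrable_AE
    proof eventually_elim
      case (elim \<omega>)
      have "state x steer t \<omega> = waypoint k \<omega> + (t - knot k) * slope k \<omega>"
        by (rule steer_state[OF elim]) (use k in \<open>auto simp: seg_def\<close>)
      then have "state x steer t \<omega> = waypoint k \<omega> + \<theta> * (waypoint (Suc k) \<omega> - waypoint k \<omega>)"
        by (simp add: \<theta>_def slope_def)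
      then have st: "state x steer t \<omega> = (1 - \<theta>) * waypoint k \<omega> + \<theta> * waypoint (Suc k) \<omega>"
        by (simp add: algebra_simps)
      have "1/2 * (state x steer t \<omega> - target t \<omega>)\<^sup>2 \<le> (state x steer t \<omega> - mart t \<omega>)\<^sup>2 + (target t \<omega> - mart t \<omega>)\<^sup>2"
        using power2_sum_le[of "state x steer t \<omega> - mart t \<omega>" "mart t \<omega> - target t \<omega>"]
        by (simp add: power2_commute[of "mart t \<omega>"])
      also have "(state x steer t \<omega> - mart t \<omega>)\<^sup>2 \<le>
          (1 - \<theta>) * (waypoint k \<omega> - mart t \<omega>)\<^sup>2 + \<theta> * (waypoint (Suc k) \<omega> - mart t \<omega>)\<^sup>2"
        unfolding st by (rule convex_square_dist[OF \<theta>])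
      finally have "ennreal (1/2 * (state x steer t \<omega> - target t \<omega>)\<^sup>2) \<le> ennreal ((target t \<omega> - mart t \<omega>)\<^sup>2 +
          ((1 - \<theta>) * (waypoint k \<omega> - mart t \<omega>)\<^sup>2 + \<theta> * (waypoint (Suc k) \<omega> - mart t \<omega>)\<^sup>2))"
        by (intro ennreal_leI) simp
      also have "\<dots> = ennreal ((target t \<omega> - mart t \<omega>)\<^sup>2) +
        (ennreal (1 - \<theta>) * ennreal ((waypoint k \<omega> - mart t \<omega>)\<^sup>2) +
         ennreal \<theta> * ennreal ((waypoint (Suc k) \<omega> - mart t \<omega>)\<^sup>2))"
        using \<theta> by (simp add: ennreal_mult)
      finally show ?case by (subst ennreal_mult[symmetric]) auto
    qed
  qed
  also have "\<dots> = (\<integral>\<^sup>+\<omega>. ennreal ((target t \<omega> - mart t \<omega>)\<^sup>2) \<partial>M) +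
      (ennreal (1 - \<theta>) * (\<integral>\<^sup>+\<omega>. ennreal ((waypoint k \<omega> - mart t \<omega>)\<^sup>2) \<partial>M) +
       ennreal \<theta> * (\<integral>\<^sup>+\<omega>. ennreal ((waypoint (Suc k) \<omega> - mart t \<omega>)\<^sup>2) \<partial>M))"
    by (simp add: nn_integral_add nn_integral_cmult)
  also have "\<dots> \<le> (\<integral>\<^sup>+\<omega>. ennreal ((target t \<omega> - mart t \<omega>)\<^sup>2) \<partial>M) +
      (ennreal (1 - \<theta>) * ((if k = 0 then gap else 0) + info_gain) +
       ennreal \<theta> * ((if k = 0 then gap else 0) + info_gain))"
  proof (intro add_left_mono add_mono mult_left_mono)
    show "(\<integral>\<^sup>+\<omega>. ennreal ((waypoint k \<omega> - mart t \<omega>)\<^sup>2) \<partial>M) \<le> (if k = 0 then gap else 0) + info_gain"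
      by (rule waypoint_dist[OF kt])
    have "(\<integral>\<^sup>+\<omega>. ennreal ((waypoint (Suc k) \<omega> - mart t \<omega>)\<^sup>2) \<partial>M) \<le> info_gain"
      using mart_knot_dist[OF kt] by (simp add: waypoint_def)
    then show "(\<integral>\<^sup>+\<omega>. ennreal ((waypoint (Suc k) \<omega> - mart t \<omega>)\<^sup>2) \<partial>M) \<le> (if k = 0 then gap else 0) + info_gain"
      by (rule order_trans) simp
  qed auto
  also have "ennreal (1 - \<theta>) * ((if k = 0 then gap else 0) + info_gain) + ennreal \<theta> * ((if k = 0 then gap else 0) + info_gain)
      = (if k = 0 then gap else 0) + info_gain"
    using \<theta> by (subst distrib_right[symmetric], subst ennreal_plus[symmetric]) auto
  also have "(if k = 0 then gap else 0) \<le> indicator {\<tau><..knot 1} t * gap"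
    using k by (auto simp: seg_def)
  finally show ?thesis
    by (subst nn_integral_cmult[symmetric]) (auto simp: add_ac add_left_mono)
qed

lemma steer_tracking:
  "ennreal (1/2) * (\<integral>\<^sup>+t\<in>{0..T}. (\<integral>\<^sup>+\<omega>. ennreal ((state x steer t \<omega> - target t \<omega>)\<^sup>2) \<partial>M) \<partial>lborel) \<le>
    ennreal (1/2) * (\<integral>\<^sup>+t\<in>{0..T}. (\<integral>\<^sup>+\<omega>. ennreal ((state x w t \<omega> - target t \<omega>)\<^sup>2) \<partial>M) \<partial>lborel)
    + (\<integral>\<^sup>+t\<in>{\<tau>..T}. (\<integral>\<^sup>+\<omega>. ennreal ((target t \<omega> - mart t \<omega>)\<^sup>2) \<partial>M) \<partial>lborel)
    + ennreal ((T - \<tau>) / 2) * gap + ennreal (T - \<tau>) * info_gain"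
proof -
  define A where "A t = (\<integral>\<^sup>+\<omega>. ennreal ((state x w t \<omega> - target t \<omega>)\<^sup>2) \<partial>M)" for t
  define B where "B t = (\<integral>\<^sup>+\<omega>. ennreal ((target t \<omega> - mart t \<omega>)\<^sup>2) \<partial>M)" for t
  define C where "C t = (\<integral>\<^sup>+\<omega>. ennreal ((state x steer t \<omega> - target t \<omega>)\<^sup>2) \<partial>M)" for t
  have [measurable]: "A \<in> borel_measurable borel" "B \<in> borel_measurable borel" "C \<in> borel_measurable borel"
    unfolding A_def B_def C_def by measurable
  have "ennreal (1/2) * (\<integral>\<^sup>+t\<in>{0..T}. C t \<partial>lborel) = (\<integral>\<^sup>+t. ennreal (1/2) * (C t * indicator {0..T} t) \<partial>lborel)"
    by (rule nn_integral_cmult[symmetric]) measurable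
  also have "\<dots> \<le> (\<integral>\<^sup>+t. ennreal (1/2) * (A t * indicator {0..T} t) + B t * indicator {\<tau>..T} t
      + gap * indicator {\<tau><..knot 1} t + info_gain * indicator {\<tau><..T} t \<partial>lborel)"
  proof (rule nn_integral_mono_AE)
    \<comment> \<open>At \<open>T\<close> itself no segment is available; the single time is
      discarded as a null set.\<close>
    have "AE t in lborel. t \<noteq> T" by (rule AE_lborel_singleton)
    then show "AE t in lborel. ennreal (1/2) * (C t * indicator {0..T} t) \<le>
      ennreal (1/2) * (A t * indicator {0..T} t) + B t * indicator {\<tau>..T} t
      + gap * indicator {\<tau><..knot 1} t + info_gain * indicator {\<tau><..T} t"
    proof eventually_elim
      case (elim t)
      consider "t < 0 \<or> t > T" | "t \<in> {0..\<tau>}" | "t \<in> {\<tau><..<T}" using elim by force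
      then show ?case
      proof cases
        case 2
        then have "C t = A t" by (simp add: A_def C_def steer_state_before)
        then show ?thesis by (simp add: add.assoc)
      next
        case 3
        have "ennreal (1/2) * C t \<le> B t + indicator {\<tau><..knot 1} t * gap + info_gain"
          using steer_tracking_after[OF 3] by (simp add: B_def C_def)
        also have "\<dots> \<le> ennreal (1/2) * A t + (B t + indicator {\<tau><..knot 1} t * gap + info_gain)"
          by simp
        finally show ?thesis using 3 tau by (simp add: ac_simps)
      qed auto
    qed
  qed
  also have "\<dots> = ennreal (1/2) * (\<integral>\<^sup>+t\<in>{0..T}. A t \<partial>lborel) + (\<integral>\<^sup>+t\<in>{\<tau>..T}. B t \<partial>lborel)
      + gap * emeasure lborel {\<tau><..knot 1} + info_gain * emeasure lborel {\<tau><..T}"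
    by (simp add: nn_integral_add nn_integral_cmult del: ennreal_half)
  also have "emeasure lborel {\<tau><..knot 1} = ennreal ((T - \<tau>) / 2)"
    using emeasure_seg[of 0] by (simp add: seg_def len_def)
  also have "emeasure lborel {\<tau><..T} = ennreal (T - \<tau>)" using tau by simp
  finally show ?thesis by (simp add: A_def B_def C_def mult.commute del: ennreal_half)
qed

text \<open>The gap is charged for tracking on the first segment and, as
  \<open>\<kappa>/2 * (2 / (T - \<tau>))\<close>, for energy. The information is charged
  \<open>(T - \<tau>)^2\<close>, since \<open>info_gain\<close> contributes one further factor
  \<open>T - \<tau>\<close>, and \<open>\<kappa>/2 * 4\<close> for energy.\<close>

lemma constrained_value_le:
  assumes "0 \<le> \<kappa>"
  shows "constrained_value M T F x \<xi> \<Xi>\<^sub>T \<kappa> \<le>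
    ennreal (1/2) * (\<integral>\<^sup>+t\<in>{0..T}. (\<integral>\<^sup>+\<omega>. ennreal ((state x w t \<omega> - target t \<omega>)\<^sup>2) \<partial>M) \<partial>lborel)
    + ennreal (\<kappa>/2) * time_energy M 0 T w
    + (\<integral>\<^sup>+t\<in>{\<tau>..T}. (\<integral>\<^sup>+\<omega>. ennreal ((target t \<omega> - mart t \<omega>)\<^sup>2) \<partial>M) \<partial>lborel)
    + ennreal ((T - \<tau>) / 2 + \<kappa> / (T - \<tau>)) * gap + ennreal ((T - \<tau>)\<^sup>2 + 2 * \<kappa>) * info"
proof -
  have "constrained_value M T F x \<xi> \<Xi>\<^sub>T \<kappa> \<le> cost M T x \<xi> \<kappa> steer"
    unfolding constrained_value_def by (rule INF_lower[OF steer_constrained])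
  also have "\<dots> \<le> (ennreal (1/2) * (\<integral>\<^sup>+t\<in>{0..T}. (\<integral>\<^sup>+\<omega>. ennreal ((state x w t \<omega> - target t \<omega>)\<^sup>2) \<partial>M) \<partial>lborel)
    + (\<integral>\<^sup>+t\<in>{\<tau>..T}. (\<integral>\<^sup>+\<omega>. ennreal ((target t \<omega> - mart t \<omega>)\<^sup>2) \<partial>M) \<partial>lborel)
    + ennreal ((T - \<tau>) / 2) * gap + ennreal (T - \<tau>) * (ennreal (T - \<tau>) * info))
    + ennreal (\<kappa>/2) * (time_energy M 0 T w + gap * ennreal (2 / (T - \<tau>)) + 4 * info)"
    unfolding cost_eq[OF steer_measurable]
    by (intro add_mono mult_left_mono steer_energy order_trans[OF steer_tracking] info_gain_le order_refl) auto
  also have "\<dots> = ennreal (1/2) * (\<integral>\<^sup>+t\<in>{0..T}. (\<integral>\<^sup>+\<omega>. ennreal ((state x w t \<omega> - target t \<omega>)\<^sup>2) \<partial>M) \<partial>lborel)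
    + ennreal (\<kappa>/2) * time_energy M 0 T w
    + (\<integral>\<^sup>+t\<in>{\<tau>..T}. (\<integral>\<^sup>+\<omega>. ennreal ((target t \<omega> - mart t \<omega>)\<^sup>2) \<partial>M) \<partial>lborel)
    + (ennreal ((T - \<tau>) / 2) + ennreal (\<kappa>/2) * ennreal (2 / (T - \<tau>))) * gap
    + (ennreal (T - \<tau>) * ennreal (T - \<tau>) + ennreal (\<kappa>/2) * 4) * info"
    by (simp add: algebra_simps del: ennreal_half)
  also have "ennreal ((T - \<tau>) / 2) + ennreal (\<kappa>/2) * ennreal (2 / (T - \<tau>)) = ennreal ((T - \<tau>) / 2 + \<kappa> / (T - \<tau>))"
    using tau assms by (subst ennreal_mult[symmetric]) (auto simp: ennreal_plus[symmetric] simp del: ennreal_plus)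
  also have "ennreal (T - \<tau>) * ennreal (T - \<tau>) + ennreal (\<kappa>/2) * 4 = ennreal ((T - \<tau>)\<^sup>2 + 2 * \<kappa>)"
  proof -
    have "ennreal ((T - \<tau>)\<^sup>2 + 2 * \<kappa>) = ennreal ((T - \<tau>) * (T - \<tau>)) + ennreal (\<kappa>/2 * 4)"
      using tau assms by (subst ennreal_plus[symmetric]) (auto simp: power2_eq_square)
    also have "\<dots> = ennreal (T - \<tau>) * ennreal (T - \<tau>) + ennreal (\<kappa>/2) * 4"
      using tau assms by (subst (1 2) ennreal_mult) auto
    finally show ?thesis by simp
  qed
  finally show ?thesis .
qed

end

section \<open>The constrained value\<close>

context tracking_problem
begin

lemma terminal_gap_eq:
  assumes "0 < a" "2 * a \<le> T"
  shows "terminal_gap M T \<xi> \<Xi> a = (\<integral>\<^sup>+t\<in>{T - 2 * a..T}. (\<integral>\<^sup>+\<omega>. ennreal ((target t \<omega> - mart t \<omega>)\<^sup>2) \<partial>M) \<partial>lborel)"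
proof -
  have "terminal_gap M T \<xi> \<Xi> a = time_energy M (T - 2 * a) T (\<lambda>t \<omega>. target t \<omega> - mart t \<omega>)"
    unfolding terminal_gap_def using assms by (intro time_energy_cong) (simp add: target_def mart_def clamp_id)
  then show ?thesis by (subst (asm) time_energy_swap) auto
qed

lemma initial_gap_finite: "initial_gap < \<top>"
proof -
  have "\<xi> 0 \<in> borel_measurable M"
    using F_measurable_imp_measurable[OF progressive_adapted[OF progressive_xi, of 0]] T_pos by simp
  then have "integrable M (\<lambda>\<omega>. (x - \<xi> 0 \<omega>)\<^sup>2)"
    using xi_zero_L2 by (intro integrable_diff_squared) auto
  from nn_integral_eq_integral[OF this] show ?thesis by (simp add: initial_gap_def)
qed

lemma warmup_energy_finite:
  assumes "0 < a"
  shows "time_energy M 0 T (warmup a) < \<top>"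
proof -
  have "ennreal (a\<^sup>2) * time_energy M 0 T (warmup a) < \<top>"
    unfolding time_energy_swap[OF warmup_jointly_measurable]
    by (rule le_less_trans[OF warmup_energy[OF assms]])
       (use initial_gap_finite seminorm_finite in \<open>simp add: ennreal_mult_less_top\<close>)
  then show ?thesis using assms by (auto simp: ennreal_mult_less_top)
qed

definition gap_at :: "real \<Rightarrow> real \<Rightarrow> ennreal" where
  "gap_at a \<tau> = (\<integral>\<^sup>+\<omega>. ennreal ((state x (warmup a) \<tau> \<omega> - mart \<tau> \<omega>)\<^sup>2) \<partial>M)"

lemma state_warmup_measurable [measurable]:
  "(\<lambda>(t, \<omega>). state x (warmup a) t \<omega>) \<in> borel_measurable (borel \<Otimes>\<^sub>M M)"
  by (rule state_jointly_measurable[OF warmup_jointly_measurable])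

lemma gap_at_measurable [measurable]: "gap_at a \<in> borel_measurable borel"
  unfolding gap_at_def[abs_def] by measurable

text \<open>For \<open>a \<le> T - \<tau> \<le> 2 * a\<close> and \<open>\<kappa> = a^2\<close>, the
  weight of the gap is at most \<open>a + a\<close>, where the lower bound on
  \<open>T - \<tau>\<close> serves the energy part, and that of the information at most
  \<open>4 * a^2 + 2 * a^2\<close>. All terms but the gap are free of \<open>\<tau>\<close>, ready
  for averaging.\<close>

lemma constrained_value_le_gap_at:
  assumes a: "0 < a" "2 * a \<le> T" and \<tau>: "\<tau> \<in> {T - 2 * a..T - a}"
  shows "constrained_value M T F x \<xi> \<Xi>\<^sub>T (a\<^sup>2) \<le>
    ennreal (1/2) * (ennreal a * (2 * seminorm + initial_gap)) + ennreal a * (seminorm + initial_gap)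
    + terminal_gap M T \<xi> \<Xi> a + ennreal (6 * a\<^sup>2) * terminal_information M T \<Xi> a
    + ennreal (2 * a) * gap_at a \<tau>"
proof (cases "gap_at a \<tau> < \<top>")
  case True
  interpret S: dyadic_steering M T F \<xi> \<Xi> \<Xi>\<^sub>T x "warmup a" \<tau>
    using a \<tau> True warmup_energy_finite progressive_warmup
    by unfold_locales (auto simp: gap_at_def)
  have gap: "S.gap = gap_at a \<tau>" by (simp add: S.gap_def gap_at_def)
  have info: "S.info \<le> terminal_information M T \<Xi> a"
    unfolding S.info_def terminal_information_def information_integral_def
    using \<tau> by (intro nn_integral_mono) (auto simp: indicator_def)
  have l: "a \<le> T - \<tau>" "T - \<tau> \<le> 2 * a" using \<tau> by auto
  have "(T - \<tau>) / 2 + a\<^sup>2 / (T - \<tau>) \<le> 2 * a"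
  proof -
    have "a\<^sup>2 / (T - \<tau>) \<le> a\<^sup>2 / a" using l a by (intro divide_left_mono) auto
    also have "a\<^sup>2 / a = a" using a by (simp add: power2_eq_square)
    finally show ?thesis
      using add_mono[of "(T - \<tau>) / 2" a "a\<^sup>2 / (T - \<tau>)" a] l by simp
  qed
  then have g: "ennreal ((T - \<tau>) / 2 + a\<^sup>2 / (T - \<tau>)) \<le> ennreal (2 * a)" by (rule ennreal_leI)
  have "(T - \<tau>)\<^sup>2 \<le> (2 * a)\<^sup>2" using l a by (intro power_mono) auto
  then have "(T - \<tau>)\<^sup>2 + 2 * a\<^sup>2 \<le> 6 * a\<^sup>2" by (simp add: power_mult_distrib)
  then have i: "ennreal ((T - \<tau>)\<^sup>2 + 2 * a\<^sup>2) \<le> ennreal (6 * a\<^sup>2)" by (rule ennreal_leI)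
  have e: "ennreal (a\<^sup>2 / 2) * time_energy M 0 T (warmup a) \<le> ennreal a * (seminorm + initial_gap)"
  proof -
    have "ennreal (a\<^sup>2 / 2) * time_energy M 0 T (warmup a) = ennreal (1/2) * (ennreal (a\<^sup>2) * time_energy M 0 T (warmup a))"
      by (simp add: mult.assoc[symmetric] ennreal_mult'[symmetric] del: ennreal_half)
    also have "\<dots> \<le> ennreal (1/2) * (ennreal (2 * a) * (seminorm + initial_gap))"
      unfolding time_energy_swap[OF warmup_jointly_measurable]
      by (intro mult_left_mono warmup_energy a) simp
    also have "\<dots> = ennreal a * (seminorm + initial_gap)"
      using a by (simp add: mult.assoc[symmetric] ennreal_mult'[symmetric] del: ennreal_half)
    finally show ?thesis .
  qed
  have th: "(\<integral>\<^sup>+t\<in>{\<tau>..T}. (\<integral>\<^sup>+\<omega>. ennreal ((target t \<omega> - mart t \<omega>)\<^sup>2) \<partial>M) \<partial>lborel) \<le> terminal_gap M T \<xi> \<Xi> a"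
    unfolding terminal_gap_eq[OF a] using \<tau> by (intro nn_integral_mono) (auto simp: indicator_def)
  have "constrained_value M T F x \<xi> \<Xi>\<^sub>T (a\<^sup>2) \<le>
    ennreal (1/2) * (ennreal a * (2 * seminorm + initial_gap)) + ennreal a * (seminorm + initial_gap)
    + terminal_gap M T \<xi> \<Xi> a + ennreal (2 * a) * gap_at a \<tau> + ennreal (6 * a\<^sup>2) * terminal_information M T \<Xi> a"
    by (rule order_trans[OF S.constrained_value_le])
       (use a in \<open>auto intro!: add_mono mult_left_mono[OF warmup_tracking] mult_mono e th g i info simp: gap simp del: ennreal_half ennreal_plus\<close>)
  then show ?thesis by (simp add: ac_simps del: ennreal_half)
next
  case False
  \<comment> \<open>The steering construction requires a finite gap; otherwise the right side is
    \<open>\<top>\<close> because \<open>2 * a > 0\<close>.\<close>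
  then have "gap_at a \<tau> = \<top>" using less_top by blast
  then show ?thesis using a by (simp add: ennreal_mult_top)
qed

text \<open>The gap is split at \<open>target\<close>. The averaging range lies in
  \<open>{0..T}\<close>, where \<open>warmup_tracking\<close> applies, and in
  \<open>{T - 2 * a..T}\<close>, the window of \<open>\<Theta>\<close>.\<close>

lemma gap_at_integral:
  assumes a: "0 < a" "2 * a \<le> T"
  shows "(\<integral>\<^sup>+\<tau>\<in>{T - 2 * a..T - a}. gap_at a \<tau> \<partial>lborel)
    \<le> 2 * (ennreal a * (2 * seminorm + initial_gap)) + 2 * terminal_gap M T \<xi> \<Xi> a"
proof -
  define A where "A t = (\<integral>\<^sup>+\<omega>. ennreal ((state x (warmup a) t \<omega> - target t \<omega>)\<^sup>2) \<partial>M)" for t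
  define B where "B t = (\<integral>\<^sup>+\<omega>. ennreal ((target t \<omega> - mart t \<omega>)\<^sup>2) \<partial>M)" for t
  have [measurable]: "A \<in> borel_measurable borel" "B \<in> borel_measurable borel"
    unfolding A_def B_def by measurable
  have le: "gap_at a t \<le> 2 * A t + 2 * B t" for t
  proof -
    have "gap_at a t \<le> (\<integral>\<^sup>+\<omega>. 2 * ennreal ((state x (warmup a) t \<omega> - target t \<omega>)\<^sup>2) + 2 * ennreal ((target t \<omega> - mart t \<omega>)\<^sup>2) \<partial>M)"
      unfolding gap_at_def
    proof (rule nn_integral_mono)
      fix \<omega>
      have "ennreal ((state x (warmup a) t \<omega> - mart t \<omega>)\<^sup>2) \<le>
        ennreal (2 * (state x (warmup a) t \<omega> - target t \<omega>)\<^sup>2 + 2 * (target t \<omega> - mart t \<omega>)\<^sup>2)"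
        using power2_sum_le[of "state x (warmup a) t \<omega> - target t \<omega>" "target t \<omega> - mart t \<omega>"]
        by (intro ennreal_leI) simp
      then show "ennreal ((state x (warmup a) t \<omega> - mart t \<omega>)\<^sup>2) \<le>
        2 * ennreal ((state x (warmup a) t \<omega> - target t \<omega>)\<^sup>2) + 2 * ennreal ((target t \<omega> - mart t \<omega>)\<^sup>2)"
        by (simp add: ennreal_mult)
    qed
    also have "\<dots> = 2 * A t + 2 * B t"
      unfolding A_def B_def by (simp add: nn_integral_add nn_integral_cmult)
    finally show ?thesis .
  qed
  have "(\<integral>\<^sup>+\<tau>\<in>{T - 2 * a..T - a}. gap_at a \<tau> \<partial>lborel) \<le>
      (\<integral>\<^sup>+t. 2 * (A t * indicator {0..T} t) + 2 * (B t * indicator {T - 2 * a..T} t) \<partial>lborel)"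
    using le a by (intro nn_integral_mono) (auto simp: indicator_def)
  also have "\<dots> = 2 * (\<integral>\<^sup>+t\<in>{0..T}. A t \<partial>lborel) + 2 * (\<integral>\<^sup>+t\<in>{T - 2 * a..T}. B t \<partial>lborel)"
    by (simp add: nn_integral_add nn_integral_cmult)
  also have "\<dots> \<le> 2 * (ennreal a * (2 * seminorm + initial_gap)) + 2 * terminal_gap M T \<xi> \<Xi> a"
    unfolding terminal_gap_eq[OF a] A_def B_def
    by (intro add_mono mult_left_mono warmup_tracking a) auto
  finally show ?thesis .
qed

text \<open>The left side does not depend on \<open>\<tau>\<close>, so integrating over a range of
  length \<open>a\<close> and dividing by \<open>a\<close> averages the right side. The gap term
  becomes \<open>2 * a * (2 * D + 2 * \<Theta>) / a\<close>, that is
  \<open>4 * D + 4 * \<Theta>\<close>.\<close>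

lemma constrained_value_bound:
  assumes a: "0 < a" "2 * a \<le> T"
  shows "constrained_value M T F x \<xi> \<Xi>\<^sub>T (a\<^sup>2) \<le> ennreal (6 * a) * (initial_gap + 2 * seminorm)
    + 6 * terminal_gap M T \<xi> \<Xi> a + ennreal (6 * a\<^sup>2) * terminal_information M T \<Xi> a"
proof -
  define v where "v = constrained_value M T F x \<xi> \<Xi>\<^sub>T (a\<^sup>2)"
  define D where "D = ennreal a * (2 * seminorm + initial_gap)"
  define \<Theta> where "\<Theta> = terminal_gap M T \<xi> \<Xi> a"
  define \<Lambda> where "\<Lambda> = ennreal (6 * a\<^sup>2) * terminal_information M T \<Xi> a"
  define R where "R = ennreal (1/2) * D + ennreal a * (seminorm + initial_gap) + \<Theta> + \<Lambda>"
  define I where "I = {T - 2 * a..T - a}"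
  have I: "emeasure lborel I = ennreal a" using a by (simp add: I_def)
  have unit: "ennreal (1 / a) * ennreal a = 1" using a by (simp add: ennreal_mult'[symmetric])
  have "v * ennreal a = (\<integral>\<^sup>+\<tau>\<in>I. v \<partial>lborel)"
    using I by (simp add: nn_integral_cmult I_def)
  also have "\<dots> \<le> (\<integral>\<^sup>+\<tau>. R * indicator I \<tau> + ennreal (2 * a) * (gap_at a \<tau> * indicator I \<tau>) \<partial>lborel)"
  proof (rule nn_integral_mono)
    fix \<tau>
    show "v * indicator I \<tau> \<le> R * indicator I \<tau> + ennreal (2 * a) * (gap_at a \<tau> * indicator I \<tau>)"
      using constrained_value_le_gap_at[OF a, of \<tau>]
      by (auto simp: indicator_def I_def v_def R_def D_def \<Theta>_def \<Lambda>_def simp del: ennreal_half)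
  qed
  also have "\<dots> = R * ennreal a + ennreal (2 * a) * (\<integral>\<^sup>+\<tau>\<in>I. gap_at a \<tau> \<partial>lborel)"
    using I by (simp add: nn_integral_add nn_integral_cmult I_def)
  also have "\<dots> \<le> R * ennreal a + ennreal (2 * a) * (2 * D + 2 * \<Theta>)"
    using gap_at_integral[OF a] by (intro add_left_mono mult_left_mono) (auto simp: D_def \<Theta>_def I_def)
  also have "ennreal (2 * a) = 2 * ennreal a" using a by (simp add: ennreal_mult)
  finally have "v * ennreal a * ennreal (1 / a) \<le> (R * ennreal a + 2 * ennreal a * (2 * D + 2 * \<Theta>)) * ennreal (1 / a)"
    by (rule mult_right_mono) simp
  also have "\<dots> = (R + 2 * (2 * D + 2 * \<Theta>)) * (ennreal (1 / a) * ennreal a)"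
    by (simp add: algebra_simps)
  finally have "v \<le> R + 2 * (2 * D + 2 * \<Theta>)"
    using unit by (simp add: mult.assoc mult.commute[of "ennreal a"])
  \<comment> \<open>Bookkeeping, in units of \<open>a\<close> for the first two: the seminorm occurs
    1 + 1 + 8 = 10 times against 12, the initial gap 1/2 + 1 + 4 = 11/2 times against 6, and
    \<open>\<Theta>\<close> 1 + 4 times against 6. Only the constant 6 of the information term is
    attained without rounding.\<close>
  also have "\<dots> = (ennreal (1/2) * D + ennreal a * (seminorm + initial_gap) + 4 * D) + (1 + 4) * \<Theta> + \<Lambda>"
    unfolding R_def distrib_right[of 1 4] by (simp add: algebra_simps del: ennreal_half one_add_one one_plus_numeral)
  also have "\<dots> \<le> ennreal (6 * a) * (initial_gap + 2 * seminorm) + 6 * \<Theta> + \<Lambda>"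
  proof (intro add_mono order_refl)
    obtain s e where se: "seminorm = ennreal s" "0 \<le> s" "initial_gap = ennreal e" "0 \<le> e"
      using seminorm_finite initial_gap_finite by (cases seminorm; cases initial_gap) auto
    define y where "y = a * (2 * s + e)"
    have y: "D = ennreal y" "0 \<le> y"
      using se a by (simp_all add: D_def y_def ennreal_mult)
    have se': "ennreal a * (seminorm + initial_gap) = ennreal (a * (s + e))"
      using se a by (simp add: ennreal_mult)
    have "ennreal (1/2) * D + ennreal a * (seminorm + initial_gap) + 4 * D
        = ennreal (1/2 * y) + ennreal (a * (s + e)) + ennreal (4 * y)"
      unfolding y se' using y(2) by (subst (1 2) ennreal_mult) auto
    also have "\<dots> = ennreal (1/2 * y + a * (s + e) + 4 * y)"
    proof -
      have nn: "0 \<le> 1/2 * y" "0 \<le> a * (s + e)" "0 \<le> 4 * y" using y(2) se a by auto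
      show ?thesis
        unfolding ennreal_plus[OF add_nonneg_nonneg[OF nn(1,2)] nn(3)] ennreal_plus[OF nn(1,2)] ..
    qed
    also have "\<dots> \<le> ennreal (6 * a * (e + 2 * s))"
    proof (rule ennreal_leI)
      have "0 \<le> a * s" "0 \<le> a * e" using se a by simp_all
      then show "1/2 * y + a * (s + e) + 4 * y \<le> 6 * a * (e + 2 * s)"
        by (simp add: y_def algebra_simps)
    qed
    also have "\<dots> = ennreal (6 * a) * (initial_gap + 2 * seminorm)"
      using se a by (simp add: ennreal_mult)
    finally show "ennreal (1/2) * D + ennreal a * (seminorm + initial_gap) + 4 * D \<le> ennreal (6 * a) * (initial_gap + 2 * seminorm)" .
    show "(1 + 4) * \<Theta> \<le> 6 * \<Theta>" by (intro mult_right_mono) auto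
  qed
  finally show ?thesis by (simp add: v_def \<Theta>_def \<Lambda>_def)
qed

text \<open>Since \<open>enn2real\<close> sends \<open>\<top>\<close> to 0, a growth bound on
  \<open>enn2real\<close> of \<open>\<Theta>\<close> controls \<open>\<Theta>\<close> only once it
  is known to be finite. Finiteness follows from the energy of \<open>\<xi>\<close> and from second
  moments of the martingale bounded by the one at \<open>T\<close>.\<close>

lemma terminal_gap_finite:
  assumes "0 < a" "2 * a \<le> T"
  shows "terminal_gap M T \<xi> \<Xi> a < \<top>"
proof -
  have "second_moment t \<le> second_moment T" for t
  proof -
    have "second_moment t = second_moment (max 0 (min T t))" by (simp add: second_moment_def mart_def)
    then show ?thesis using second_moment_mono[of "max 0 (min T t)" T] T_pos by simp
  qed
  then have m: "(\<integral>\<^sup>+\<omega>. ennreal ((mart t \<omega>)\<^sup>2) \<partial>M) \<le> ennreal (second_moment T)" for t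
    by (subst nn_integral_eq_integral) (auto simp: second_moment_def intro!: ennreal_leI)
  have "(\<integral>\<^sup>+\<omega>. ennreal ((target t \<omega> - mart t \<omega>)\<^sup>2) \<partial>M) \<le>
      2 * (\<integral>\<^sup>+\<omega>. ennreal ((target t \<omega>)\<^sup>2) \<partial>M) + 2 * ennreal (second_moment T)" for t
  proof -
    have "(\<integral>\<^sup>+\<omega>. ennreal ((target t \<omega> - mart t \<omega>)\<^sup>2) \<partial>M) \<le>
        (\<integral>\<^sup>+\<omega>. 2 * ennreal ((target t \<omega>)\<^sup>2) + 2 * ennreal ((mart t \<omega>)\<^sup>2) \<partial>M)"
    proof (rule nn_integral_mono)
      fix \<omega>
      have "ennreal ((target t \<omega> - mart t \<omega>)\<^sup>2) \<le> ennreal (2 * (target t \<omega>)\<^sup>2 + 2 * (mart t \<omega>)\<^sup>2)"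
        using power2_sum_le[of "target t \<omega>" "- mart t \<omega>"] by (intro ennreal_leI) simp
      then show "ennreal ((target t \<omega> - mart t \<omega>)\<^sup>2) \<le> 2 * ennreal ((target t \<omega>)\<^sup>2) + 2 * ennreal ((mart t \<omega>)\<^sup>2)"
        by (simp add: ennreal_mult)
    qed
    also have "\<dots> = 2 * (\<integral>\<^sup>+\<omega>. ennreal ((target t \<omega>)\<^sup>2) \<partial>M) + 2 * (\<integral>\<^sup>+\<omega>. ennreal ((mart t \<omega>)\<^sup>2) \<partial>M)"
      by (simp add: nn_integral_add nn_integral_cmult)
    finally show ?thesis using m[of t] by (meson add_left_mono mult_left_mono order_trans zero_le)
  qed
  then have "terminal_gap M T \<xi> \<Xi> a \<le> (\<integral>\<^sup>+t. 2 * ((\<integral>\<^sup>+\<omega>. ennreal ((target t \<omega>)\<^sup>2) \<partial>M) * indicator {0..T} t)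
      + 2 * ennreal (second_moment T) * indicator {0..T} t \<partial>lborel)"
    unfolding terminal_gap_eq[OF assms] using assms
    by (intro nn_integral_mono) (auto simp: indicator_def)
  also have "\<dots> = 2 * time_energy M 0 T target + 2 * ennreal (second_moment T) * ennreal T"
    using T_pos by (simp add: time_energy_swap nn_integral_add nn_integral_cmult)
  also have "time_energy M 0 T target = time_energy M 0 T \<xi>"
    by (rule time_energy_cong) (simp add: target_def clamp_id)
  also have "2 * time_energy M 0 T \<xi> + 2 * ennreal (second_moment T) * ennreal T < \<top>"
    using xi_energy by (simp add: ennreal_mult_less_top)
  finally show ?thesis .
qed

text \<open>A bound uniform in \<open>a\<close>: the information term of the estimate is therefore
  of order \<open>\<kappa>\<close>, below \<open>sqrt \<kappa>\<close>.\<close>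

lemma terminal_information_le:
  assumes "2 * a \<le> T"
  shows "terminal_information M T \<Xi> a \<le> information_integral M T \<Xi> 0"
  unfolding terminal_information_def information_integral_def
  using assms by (intro nn_integral_mono) (auto simp: indicator_def)

end

theorem corollary3p5:
  fixes M :: "'a measure" and T :: real and F :: "real \<Rightarrow> 'a measure"
    and \<xi> \<Xi> :: "real \<Rightarrow> 'a \<Rightarrow> real" and \<Xi>\<^sub>T :: "'a \<Rightarrow> real" and x :: real
  assumes "usual_filtered_prob_space M T F"
    and "progressive T F \<xi>"
    and "integrable M (\<lambda>\<omega>. (\<xi> 0 \<omega>)\<^sup>2)"
    and "time_energy M 0 T \<xi> < \<top>"
    and "\<Xi>\<^sub>T \<in> borel_measurable (F T)"
    and "integrable M (\<lambda>\<omega>. (\<Xi>\<^sub>T \<omega>)\<^sup>2)"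
    and "cadlag_cond_exp M T F \<Xi>\<^sub>T \<Xi>"
    and "information_integral M T \<Xi> 0 < \<top>"
    and "transl_seminorm_sq M T \<xi> < \<top>"
  shows "(\<forall>\<kappa>\<in>{0<..T\<^sup>2 / 4}.
            constrained_value M T F x \<xi> \<Xi>\<^sub>T \<kappa>
              \<le> ennreal (6 * sqrt \<kappa>) *
                    ((\<integral>\<^sup>+\<omega>. ennreal ((x - \<xi> 0 \<omega>)\<^sup>2) \<partial>M) + 2 * transl_seminorm_sq M T \<xi>)
                + 6 * terminal_gap M T \<xi> \<Xi> (sqrt \<kappa>)
                + ennreal (6 * \<kappa>) * terminal_information M T \<Xi> (sqrt \<kappa>))
       \<and> ((\<lambda>a. enn2real (terminal_gap M T \<xi> \<Xi> a)) \<in> O[at_right 0](\<lambda>a. a)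
            \<longrightarrow> (\<lambda>\<kappa>. enn2real (constrained_value M T F x \<xi> \<Xi>\<^sub>T \<kappa>)) \<in> O[at_right 0](\<lambda>\<kappa>. sqrt \<kappa>))"
proof -
  interpret U: usual_filtered_prob_space M T F by fact
  interpret tracking_problem M T F \<xi> \<Xi> \<Xi>\<^sub>T x
    by unfold_locales (use assms in auto)
  have half: "2 * sqrt \<kappa> \<le> T" if "\<kappa> \<in> {0<..T\<^sup>2 / 4}" for \<kappa>
  proof -
    have "sqrt \<kappa> \<le> sqrt ((T / 2)\<^sup>2)"
      using that by (intro real_sqrt_le_mono) (simp add: power_divide)
    then show ?thesis using U.T_pos by (simp del: real_sqrt_pow2)
  qed
  have bound: "constrained_value M T F x \<xi> \<Xi>\<^sub>T \<kappa> \<le> ennreal (6 * sqrt \<kappa>) * (initial_gap + 2 * seminorm)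
      + 6 * terminal_gap M T \<xi> \<Xi> (sqrt \<kappa>) + ennreal (6 * \<kappa>) * terminal_information M T \<Xi> (sqrt \<kappa>)"
    if "\<kappa> \<in> {0<..T\<^sup>2 / 4}" for \<kappa>
    using constrained_value_bound[of "sqrt \<kappa>"] half[OF that] that by simp
  moreover have "(\<lambda>\<kappa>. enn2real (constrained_value M T F x \<xi> \<Xi>\<^sub>T \<kappa>)) \<in> O[at_right 0](\<lambda>\<kappa>. sqrt \<kappa>)"
    if "(\<lambda>a. enn2real (terminal_gap M T \<xi> \<Xi> a)) \<in> O[at_right 0](\<lambda>a. a)"
  proof -
    from that obtain c where c: "c > 0"
      "\<forall>\<^sub>F a in at_right 0. norm (enn2real (terminal_gap M T \<xi> \<Xi> a)) \<le> c * norm a"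
      by (elim landau_o.bigE)
    obtain s e l where sel: "seminorm = ennreal s" "0 \<le> s" "initial_gap = ennreal e" "0 \<le> e"
      "information_integral M T \<Xi> 0 = ennreal l" "0 \<le> l"
      using seminorm_finite initial_gap_finite information_finite
      by (cases seminorm; cases initial_gap; cases "information_integral M T \<Xi> 0") auto
    \<comment> \<open>Permits substituting \<open>a = sqrt \<kappa>\<close> in the assumed growth of
      \<open>\<Theta>\<close>.\<close>
    have "filterlim sqrt (at_right 0) (at_right 0)"
      unfolding filterlim_at
    proof
      show "\<forall>\<^sub>F \<kappa> in at_right 0. sqrt \<kappa> \<in> {0<..} \<and> sqrt \<kappa> \<noteq> 0"
        by (rule eventually_at_rightI[where b = 1]) auto
      show "(sqrt \<longlongrightarrow> 0) (at_right 0)"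
        using tendsto_real_sqrt[OF tendsto_ident_at, of 0 "{0<..}"] by simp
    qed
    from eventually_compose_filterlim[OF c(2) this]
    have ev: "\<forall>\<^sub>F \<kappa> in at_right 0. norm (enn2real (terminal_gap M T \<xi> \<Xi> (sqrt \<kappa>))) \<le> c * norm (sqrt \<kappa>)" .
    have small: "\<forall>\<^sub>F \<kappa> in at_right 0. \<kappa> \<in> {0<..T\<^sup>2 / 4} \<and> \<kappa> \<le> 1"
      using U.T_pos by (intro eventually_at_rightI[where b = "min (T\<^sup>2 / 4) 1"]) auto
    show ?thesis
    proof (rule landau_o.bigI)
      show "6 * (e + 2 * s) + 6 * c + 6 * l + 1 > 0" using sel c by (intro add_nonneg_pos) auto
      show "\<forall>\<^sub>F \<kappa> in at_right 0. norm (enn2real (constrained_value M T F x \<xi> \<Xi>\<^sub>T \<kappa>))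
          \<le> (6 * (e + 2 * s) + 6 * c + 6 * l + 1) * norm (sqrt \<kappa>)"
        using ev small
      proof eventually_elim
        case (elim \<kappa>)
        define a where "a = sqrt \<kappa>"
        have a: "0 < a" "2 * a \<le> T" using elim half[of \<kappa>] by (auto simp: a_def)
        have \<kappa>: "\<kappa> = a * a" "0 < \<kappa>" using elim by (auto simp: a_def)
        have "a \<le> 1" using elim by (simp add: a_def)
        obtain \<theta> where \<theta>: "terminal_gap M T \<xi> \<Xi> a = ennreal \<theta>" "0 \<le> \<theta>"
          using terminal_gap_finite[OF a] by (cases "terminal_gap M T \<xi> \<Xi> a") auto
        have \<theta>c: "\<theta> \<le> c * a" using elim(1) \<theta> a by (simp add: a_def[symmetric])
        have "constrained_value M T F x \<xi> \<Xi>\<^sub>T \<kappa> \<le> ennreal (6 * a) * (initial_gap + 2 * seminorm)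
          + 6 * terminal_gap M T \<xi> \<Xi> a + ennreal (6 * \<kappa>) * terminal_information M T \<Xi> a"
          using bound elim(2) by (simp add: a_def)
        also have "\<dots> \<le> ennreal (6 * a) * (initial_gap + 2 * seminorm)
          + 6 * terminal_gap M T \<xi> \<Xi> a + ennreal (6 * \<kappa>) * information_integral M T \<Xi> 0"
          by (intro add_left_mono mult_left_mono terminal_information_le a) simp
        also have "\<dots> = ennreal (6 * a * (e + 2 * s) + 6 * \<theta> + 6 * \<kappa> * l)"
          using sel a \<theta> \<kappa> by (simp add: ennreal_mult)
        \<comment> \<open>The upper bound is a finite real, so the default of
          \<open>enn2real\<close> at \<open>\<top>\<close> does no harm.\<close>
        finally have "enn2real (constrained_value M T F x \<xi> \<Xi>\<^sub>T \<kappa>) \<le> 6 * a * (e + 2 * s) + 6 * \<theta> + 6 * \<kappa> * l"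
          using sel a \<theta> \<kappa> by (intro enn2real_leI) auto
        also have "\<dots> \<le> 6 * a * (e + 2 * s) + 6 * (c * a) + 6 * (a * l)"
        proof -
          \<comment> \<open>From \<open>\<kappa> = a * a\<close> and \<open>a \<le> 1\<close>, the
            reason for restricting to \<open>\<kappa> \<le> 1\<close>.\<close>
          have "\<kappa> * l \<le> a * l"
            unfolding \<kappa> using a \<open>a \<le> 1\<close> sel by (intro mult_right_mono) (auto simp: mult_left_le)
          with \<theta>c show ?thesis by simp
        qed
        also have "\<dots> \<le> (6 * (e + 2 * s) + 6 * c + 6 * l + 1) * a"
          using a by (simp add: algebra_simps)
        finally show ?case using a by (simp add: a_def[symmetric])
      qed
    qed
  qed
  ultimately show ?thesis unfolding initial_gap_def by blast
qed

end
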